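(* Let $M,m,A,A_1,B,B_1>0$, $\mu:=\frac{2M+m}{m}$, $\gamma:=\frac{16B_1}{B}$, and assume $\mu>1+\frac{A}{4A_1}$, $\mu>1+\frac{B}{16B_1}$ and $(\mu-1)^{4/15}\left(\frac{4A_1}{A}\right)^{2/3}\neq\left(\frac{16B_1}{B}\right)^{2/5}$. If $$\cos^2\left(\left(\frac{4}{1+\gamma}\right)^{1/2}\left(1-\frac1\mu\right)^{3/4}\left(1+\frac{\gamma^{2/5}}{(\mu-1)^{3/5}}\right)^{5/4}\right)\le\frac{1}{\left(1-\frac1\mu\right)\left(1+\frac{\gamma^{2/5}}{(\mu-1)^{3/5}}\right)},$$ then on the triple collision manifold $\Delta$ the branch $\mathcal W_u(E_-)\big|_{w>0}$ of the unstable manifold of $E_-$ ends in $\mathcal B_+(0)$, i.e. $\theta\to\pi/2$ and $w\to0$ along it as time tends to $+\infty$.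
   Context: Let $W(\theta)=\left(\tfrac M2\right)^{3/2}\left(\tfrac{B}{\cos^3\theta}+\tfrac{16B_1}{(\cos^2\theta+\mu\sin^2\theta)^{3/2}}\right)$ and $U(\theta)=W(\theta)\cos^3\theta$ (positive on $[-\pi/2,\pi/2]$). The triple collision manifold of the isosceles Schwarzschild problem is $$\Delta=\left\{(v,\theta,w)\in\mathbb R\times[-\tfrac\pi2,\tfrac\pi2]\times\mathbb R:\ w^2+\tfrac{\cos^6\theta}{U(\theta)}v^2=2\cos^3\theta\right\}$$ (the set $r=0$), with the flow of $$v'=\tfrac{\cos^3\theta}{2\sqrt U}v^2-\sqrt U,\quad \theta'=w,\quad w'=\tfrac{\cos^3\theta}{2\sqrt U}vw+\tfrac{U'(\theta)}{U}\left(\cos^3\theta-\tfrac{w^2}{2}\right)-3\sin\theta\cos^2\theta+\tfrac{3\sin\theta\cos^5\theta}{U}v^2 .$$ The angle $\theta_w\in(0,\pi/2)$ is defined by $\cos\theta_w=\sqrt{\frac{\mu}{(\mu-1)+(\mu-1)^{2/5}\gamma^{2/5}}}$. In coordinates $(v,\theta,w)$, $E_-=(\sqrt{2W(\theta_w)},-\theta_w,0)$, an equilibrium on $\Delta$ with one-dimensional unstable manifold $\mathcal W_u(E_-)$ in $\Delta$; $\mathcal W_u(E_-)|_{w>0}$ denotes its branch leaving $E_-$ into $w>0$. $\mathcal B_+(0)=\{\theta=\pi/2,\ w=0\}\subset\Delta$. *)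

theory Defs
  imports "HOL-Analysis.Analysis"
begin

definition W :: "real \<Rightarrow> real \<Rightarrow> real \<Rightarrow> real \<Rightarrow> real \<Rightarrow> real" where
  "W M \<mu> B B1 \<theta> = (M / 2) powr (3/2) *
     (B / cos \<theta> ^ 3 + 16 * B1 / ((cos \<theta>)\<^sup>2 + \<mu> * (sin \<theta>)\<^sup>2) powr (3/2))"

(* U is W * cos^3, multiplied out: as x / 0 = 0, the literal product would vanish at the
   collision angles -pi/2 and pi/2, where the continuous extension is positive. *)
definition U :: "real \<Rightarrow> real \<Rightarrow> real \<Rightarrow> real \<Rightarrow> real \<Rightarrow> real" where
  "U M \<mu> B B1 \<theta> = (M / 2) powr (3/2) *
     (B + 16 * B1 * cos \<theta> ^ 3 / ((cos \<theta>)\<^sup>2 + \<mu> * (sin \<theta>)\<^sup>2) powr (3/2))"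

lemma U_eq_W_cos3: "cos \<theta> \<noteq> 0 \<Longrightarrow> U M \<mu> B B1 \<theta> = W M \<mu> B B1 \<theta> * cos \<theta> ^ 3"
  by (simp add: U_def W_def field_simps)

definition triple_collision_manifold ::
    "real \<Rightarrow> real \<Rightarrow> real \<Rightarrow> real \<Rightarrow> (real \<times> real \<times> real) set" where
  "triple_collision_manifold M \<mu> B B1 =
     {(v, \<theta>, w). - (pi / 2) \<le> \<theta> \<and> \<theta> \<le> pi / 2 \<and>
        w\<^sup>2 + cos \<theta> ^ 6 / U M \<mu> B B1 \<theta> * v\<^sup>2 = 2 * cos \<theta> ^ 3}"

definition schwarzschild_field ::
    "real \<Rightarrow> real \<Rightarrow> real \<Rightarrow> real \<Rightarrow> real \<times> real \<times> real \<Rightarrow> real \<times> real \<times> real" where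
  "schwarzschild_field M \<mu> B B1 = (\<lambda>(v, \<theta>, w).
     (cos \<theta> ^ 3 / (2 * sqrt (U M \<mu> B B1 \<theta>)) * v\<^sup>2 - sqrt (U M \<mu> B B1 \<theta>),
      w,
      cos \<theta> ^ 3 / (2 * sqrt (U M \<mu> B B1 \<theta>)) * v * w
        + deriv (U M \<mu> B B1) \<theta> / U M \<mu> B B1 \<theta> * (cos \<theta> ^ 3 - w\<^sup>2 / 2)
        - 3 * sin \<theta> * (cos \<theta>)\<^sup>2
        + 3 * sin \<theta> * cos \<theta> ^ 5 / U M \<mu> B B1 \<theta> * v\<^sup>2))"

definition theta_w :: "real \<Rightarrow> real \<Rightarrow> real" where
  "theta_w \<mu> \<gamma> = arccos (sqrt (\<mu> / ((\<mu> - 1) + (\<mu> - 1) powr (2/5) * \<gamma> powr (2/5))))"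

definition E_minus :: "real \<Rightarrow> real \<Rightarrow> real \<Rightarrow> real \<Rightarrow> real \<times> real \<times> real" where
  "E_minus M \<mu> B B1 =
     (let \<theta> = theta_w \<mu> (16 * B1 / B) in (sqrt (2 * W M \<mu> B B1 \<theta>), - \<theta>, 0))"

definition solution_in ::
    "('a::real_normed_vector \<Rightarrow> 'a) \<Rightarrow> 'a set \<Rightarrow> real set \<Rightarrow> (real \<Rightarrow> 'a) \<Rightarrow> bool" where
  "solution_in X S I x \<longleftrightarrow>
     (\<forall>t\<in>I. x t \<in> S \<and> (x has_vector_derivative X (x t)) (at t within I))"

(* Points of S whose backward orbit exists for all negative times, stays in S, tends to the
   equilibrium e and approaches it through H. With H = UNIV this is the whole unstable
   manifold of e in S; H = {w > 0} selects the branch leaving e into w > 0. *)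
definition unstable_branch ::
    "('a::real_normed_vector \<Rightarrow> 'a) \<Rightarrow> 'a set \<Rightarrow> 'a \<Rightarrow> 'a set \<Rightarrow> 'a set" where
  "unstable_branch X S e H =
     {p. \<exists>x. solution_in X S {..0} x \<and> x 0 = p \<and> (x \<longlongrightarrow> e) at_bot \<and>
             (\<forall>\<^sub>F t in at_bot. x t \<in> H)}"

end

theory Submission
  imports Defs "HOL-Complex_Analysis.Great_Picard"
begin

text \<open>
  On \<open>\<Delta>\<close> the energy relation reads \<open>w\<^sup>2 = cos\<^sup>3 \<theta> (2 - v\<^sup>2 / W)\<close>, and it turns the first equation
  into \<open>v' = - \<surd>U w\<^sup>2 / (2 cos\<^sup>3 \<theta>)\<close>, so \<open>v\<close> never increases. As long as \<open>w > 0\<close> the angle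
  can replace time, and the orbit is a solution of \<open>dv/d\<theta> = - \<surd>(2 W(\<theta>) - v\<^sup>2) / 2\<close>. The branch
  starts at \<open>\<theta> = - \<theta>\<^sub>w\<close> with \<open>v = \<surd>(2 W(\<theta>\<^sub>w))\<close>, the angles \<open>\<plusminus>\<theta>\<^sub>w\<close> being the global
  minima of \<open>W\<close>; so, \<open>v\<close> having decreased, it can turn back only where \<open>v = - \<surd>(2 W(\<theta>))\<close>.

  Up to \<open>\<theta>\<^sub>w\<close> this is excluded by a crude estimate. There \<open>W \<le> W(0)\<close>, and dropping \<open>v\<^sup>2\<close> under
  the root gives \<open>dv/d\<theta> \<ge> - k\<close> with \<open>k = \<surd>(W(0) / 2)\<close>. Hence \<open>v\<close> loses less than
  \<open>2 k \<theta>\<^sub>w\<close>, and it stays above \<open>- \<surd>(2 W(\<theta>\<^sub>w)) \<ge> - \<surd>(2 W(\<theta>))\<close> as soon as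
  \<open>k \<theta>\<^sub>w \<le> \<surd>(2 W(\<theta>\<^sub>w))\<close>, that is, \<open>\<theta>\<^sub>w \<le> 2 \<surd>(W(\<theta>\<^sub>w) / W(0))\<close>. The trigonometric hypothesis
  says precisely that \<open>cos\<^sup>2\<close> of the right-hand side is at most \<open>cos\<^sup>2 \<theta>\<^sub>w\<close> (lemmas \<open>W_ratio\<close> and
  \<open>cos_tw_sq\<close>), which implies this inequality because \<open>cos\<^sup>2\<close> decreases on \<open>[0, \<pi>/2]\<close>.
  Beyond \<open>\<theta>\<^sub>w\<close> the function \<open>W\<close> increases, and at a point with \<open>w = 0\<close> one has
  \<open>w' = cos\<^sup>3 \<theta> W' / W > 0\<close>, so \<open>w\<close> cannot reach \<open>0\<close> from above. Both facts together are
  the lemma \<open>region_turning_point\<close>.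

  Therefore \<open>w > 0\<close> along the whole orbit and \<open>\<theta>\<close> increases to a limit. Were the limit
  smaller than \<open>\<pi>/2\<close>, the orbit would converge to a point with \<open>w = 0\<close> where the same lemma
  gives \<open>w' > 0\<close>, which is impossible. So \<open>\<theta> \<rightarrow> \<pi>/2\<close>, and \<open>w \<rightarrow> 0\<close> since \<open>w\<^sup>2 \<le> 2 cos\<^sup>3 \<theta>\<close>
  (lemma \<open>forward_limits\<close>).

  The orbit has to be shown to exist for all positive times. Where \<open>w \<ge> 0\<close>, the energy
  relation expresses \<open>w\<close> by \<open>v\<close> and \<open>\<theta>\<close>, which leaves a planar system that is bounded and
  continuous once \<open>\<theta>\<close> is clamped to \<open>[-\<pi>/2, \<pi>/2]\<close>. The square root is not Lipschitz at \<open>w = 0\<close>,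
  but Peano's theorem (\<open>peano_existence\<close>) yields a global solution, and the barrier argument
  shows that the point where the root is singular is never reached (\<open>forward_solution_exists\<close>).
\<close>

section \<open>Peano's existence theorem for bounded continuous fields\<close>

definition euler :: "('a::real_normed_vector \<Rightarrow> 'a) \<Rightarrow> real \<Rightarrow> 'a \<Rightarrow> nat \<Rightarrow> 'a" where
  "euler G h p n = ((\<lambda>y. y + h *\<^sub>R G y) ^^ n) p"

text \<open>
  Between two vertices of an Euler polygon the increment is an average of the slopes used,
  so slopes close to \<open>g\<close> make it close to the elapsed time times \<open>g\<close>.
\<close>

lemma euler_increment:
  assumes "0 \<le> h" "m \<le> n"
    and slope: "\<And>k. m \<le> k \<Longrightarrow> k < n \<Longrightarrow> norm (G (euler G h p k) - g) \<le> e"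
  shows "norm (euler G h p n - euler G h p m - (real (n - m) * h) *\<^sub>R g) \<le> real (n - m) * h * e"
  using \<open>m \<le> n\<close> slope
proof (induction n rule: dec_induct)
  case base
  show ?case by simp
next
  case (step n)
  let ?y = "euler G h p"
  have split: "?y (Suc n) - ?y m - (real (Suc n - m) * h) *\<^sub>R g
      = (?y n - ?y m - (real (n - m) * h) *\<^sub>R g) + h *\<^sub>R (G (?y n) - g)"
    using step.hyps by (simp add: euler_def Suc_diff_le algebra_simps)
  have "norm (?y n - ?y m - (real (n - m) * h) *\<^sub>R g) \<le> real (n - m) * h * e"
    using step.IH step.prems by simp
  moreover have "norm (h *\<^sub>R (G (?y n) - g)) \<le> h * e"
    using step.prems[of n] step.hyps \<open>0 \<le> h\<close> by (simp add: mult_left_mono)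
  ultimately show ?case
    unfolding split using step.hyps
    by (intro order_trans[OF norm_triangle_ineq]) (simp add: Suc_diff_le algebra_simps)
qed

lemma nat_floor_times_step:
  fixes h t :: real
  assumes "0 < h" "0 \<le> t"
  shows "real (nat \<lfloor>t / h\<rfloor>) * h \<le> t" "t < real (nat \<lfloor>t / h\<rfloor>) * h + h"
proof -
  have "real (nat \<lfloor>t / h\<rfloor>) \<le> t / h" "t / h < real (nat \<lfloor>t / h\<rfloor>) + 1"
    using assms by (auto simp: of_nat_nat)
  with \<open>0 < h\<close> show "real (nat \<lfloor>t / h\<rfloor>) * h \<le> t" "t < real (nat \<lfloor>t / h\<rfloor>) * h + h"
    by (simp_all add: field_simps)
qed

text \<open>
  The approximations are step functions that run through the vertices of Euler polygons with step
  sizes tending to \<open>0\<close>. They are Lipschitz up to an error of one step, so a subsequence that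
  converges at all rational times converges at all times. Pointwise convergence is enough for the
  derivative: for short times all slopes used are close to the slope at the limit, and the resulting
  estimate of increments passes to the limit. As the bound on the field is global, so is the
  solution.
\<close>

lemma peano_existence:
  fixes G :: "'a::euclidean_space \<Rightarrow> 'a"
  assumes cont: "continuous_on UNIV G" and bound: "\<And>y. norm (G y) \<le> C"
  shows "\<exists>x. x 0 = p \<and> (\<forall>t\<ge>0. (x has_vector_derivative G (x t)) (at t within {0..}))"
proof -
  have C0: "0 \<le> C" using order_trans[OF norm_ge_zero bound] .
  define h :: "nat \<Rightarrow> real" where "h n = 1 / real (Suc n)" for n
  define N where "N n t = nat \<lfloor>t / h n\<rfloor>" for n t
  define z where "z n k = euler G (h n) p k" for n k
  define y where "y n t = z n (N n t)" for n t
  have h0: "0 < h n" and hle: "h n \<le> 1" for n by (simp_all add: h_def)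
  have hlim: "h \<longlonglongrightarrow> 0" unfolding h_def using lim_1_over_n LIMSEQ_Suc by fastforce
  have Nle: "real (N n t) * h n \<le> t" and Nge: "t < real (N n t) * h n + h n" if "0 \<le> t" for n t
    using nat_floor_times_step[OF h0 that] by (simp_all add: N_def)
  have Nmono: "N n s \<le> N n t" if "s \<le> t" for n s t
    using that h0[of n] by (simp add: N_def nat_mono floor_mono divide_right_mono)
  have zlip: "norm (z n k - z n j) \<le> real (k - j) * h n * C" if "j \<le> k" for n j k
    using euler_increment[of "h n" j k G p 0 C] that h0[of n] bound by (simp add: z_def)
  have ylip: "norm (y n t - y n s) \<le> (t - s + h n) * C" if "0 \<le> s" "s \<le> t" for n s t
  proof -
    have "norm (y n t - y n s) \<le> real (N n t - N n s) * h n * C"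
      unfolding y_def using zlip Nmono that by blast
    also have "\<dots> \<le> (t - s + h n) * C"
      using Nle[of t n] Nge[of s n] that Nmono[OF that(2), of n] C0
      by (intro mult_right_mono) (auto simp: of_nat_diff algebra_simps)
    finally show ?thesis .
  qed
  have y0: "y n 0 = p" for n by (simp add: y_def N_def z_def euler_def)
  \<comment> \<open>The factor makes the approximations uniformly bounded on the whole half-line.\<close>
  define f where "f n q = (1 / (1 + q)) *\<^sub>R y n q" for n and q :: real
  define S where "S = \<rat> \<inter> {0::real..}"
  have fbound: "norm (f n q) \<le> norm p + C" if "q \<in> S" for n q
  proof -
    have q: "0 \<le> q" using that by (simp add: S_def)
    have "norm (y n q) \<le> norm p + norm (y n q - y n 0)"
      using y0 norm_triangle_sub[of "y n q" p] by simp
    also have "\<dots> \<le> norm p + (q + h n) * C" using ylip[of 0 q n] q by simp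
    also have "\<dots> \<le> (1 + q) * norm p + (1 + q) * C"
    proof (rule add_mono)
      show "norm p \<le> (1 + q) * norm p" using q mult_right_mono[of 1 "1 + q" "norm p"] by simp
      show "(q + h n) * C \<le> (1 + q) * C" using hle[of n] C0 by (intro mult_right_mono) auto
    qed
    finally have "norm (y n q) \<le> (1 + q) * (norm p + C)" by (simp add: algebra_simps)
    then show ?thesis using q by (simp add: f_def divide_simps mult.commute)
  qed
  have "countable S" unfolding S_def using countable_rat by blast
  then obtain r :: "nat \<Rightarrow> nat" where r: "strict_mono r"
    and conv: "\<And>q. q \<in> S \<Longrightarrow> \<exists>l. (\<lambda>n. f (r n) q) \<longlonglongrightarrow> l"
    using function_convergent_subsequence[of S f "norm p + C"] fbound by metis
  have hr: "(\<lambda>n. h (r n)) \<longlonglongrightarrow> 0"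
    using LIMSEQ_subseq_LIMSEQ[OF hlim r] by (simp add: o_def)
  have convS: "convergent (\<lambda>n. y (r n) q)" if q: "q \<in> S" for q
  proof -
    from conv[OF q] obtain l where "(\<lambda>n. f (r n) q) \<longlonglongrightarrow> l" by blast
    then have "(\<lambda>n. (1 + q) *\<^sub>R f (r n) q) \<longlonglongrightarrow> (1 + q) *\<^sub>R l" by (intro tendsto_intros)
    moreover have "(1 + q) *\<^sub>R f (r n) q = y (r n) q" for n using q by (simp add: f_def S_def)
    ultimately show ?thesis by (auto simp: convergent_def)
  qed
  have "convergent (\<lambda>n. y (r n) t)" if t: "0 \<le> t" for t
  proof (rule Cauchy_convergent, rule CauchyI)
    fix e :: real assume e: "0 < e"
    define d where "d = e / (8 * (C + 1))"
    have d: "0 < d" "d * C \<le> e / 8" using e C0 by (simp_all add: d_def field_simps)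
    obtain q where q: "q \<in> \<rat>" "t < q" "q < t + d"
      using Rats_dense_in_real[of t "t + d"] d(1) by auto
    have "q \<in> S" using q t by (simp add: S_def)
    then have "Cauchy (\<lambda>n. y (r n) q)" using convS convergent_Cauchy by blast
    then obtain M1 where M1: "\<And>m n. m \<ge> M1 \<Longrightarrow> n \<ge> M1 \<Longrightarrow> norm (y (r m) q - y (r n) q) < e / 4"
      using CauchyD[of _ "e / 4"] e by fastforce
    from hr d(1) obtain M2 where M2: "\<And>n. n \<ge> M2 \<Longrightarrow> h (r n) < d"
      by (metis (mono_tags, lifting) order_tendstoD(2) eventually_sequentially)
    have near: "norm (y (r n) q - y (r n) t) \<le> e / 4" if "n \<ge> M2" for n
    proof -
      have "norm (y (r n) q - y (r n) t) \<le> (q - t + h (r n)) * C"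
        using ylip[of t q "r n"] q t by simp
      also have "\<dots> \<le> (d + d) * C" using q M2[OF that] C0 by (intro mult_right_mono) auto
      finally show ?thesis using d(2) by (simp add: algebra_simps)
    qed
    show "\<exists>M. \<forall>m\<ge>M. \<forall>n\<ge>M. norm (y (r m) t - y (r n) t) < e"
    proof (intro exI allI impI)
      fix m n assume mn: "m \<ge> max M1 M2" "n \<ge> max M1 M2"
      have "y (r m) t - y (r n) t
          = (y (r m) q - y (r n) q) - (y (r m) q - y (r m) t) + (y (r n) q - y (r n) t)" by simp
      also have "norm \<dots> \<le> norm (y (r m) q - y (r n) q) + norm (y (r m) q - y (r m) t)
          + norm (y (r n) q - y (r n) t)"
        by (meson norm_triangle_ineq norm_triangle_ineq4 order_trans add_right_mono)
      finally show "norm (y (r m) t - y (r n) t) < e"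
        using M1[of m n] near[of m] near[of n] mn e by linarith
    qed
  qed
  then have "\<forall>t. \<exists>l. 0 \<le> t \<longrightarrow> (\<lambda>n. y (r n) t) \<longlonglongrightarrow> l" by (auto simp: convergent_def)
  then obtain x where x: "\<And>t. 0 \<le> t \<Longrightarrow> (\<lambda>n. y (r n) t) \<longlonglongrightarrow> x t" by metis
  have "x 0 = p" using x[of 0] y0 by (simp add: LIMSEQ_const_iff)
  moreover have "(x has_vector_derivative G (x t)) (at t within {0..})" if t: "0 \<le> t" for t
    unfolding has_vector_derivative_def has_derivative_within_alt
  proof (intro conjI allI impI)
    show "bounded_linear (\<lambda>s. s *\<^sub>R G (x t))" by (rule bounded_linear_scaleR_left)
    fix e :: real assume e: "0 < e"
    obtain \<delta> where \<delta>: "0 < \<delta>" "\<And>a. norm (a - x t) < \<delta> \<Longrightarrow> norm (G a - G (x t)) \<le> e"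
      using cont e unfolding continuous_on_iff dist_norm by (metis UNIV_I less_imp_le)
    define d where "d = \<delta> / (4 * (C + 1))"
    have d: "0 < d" "d * C \<le> \<delta> / 4" using \<delta>(1) C0 by (simp_all add: d_def field_simps)
    have incr: "norm (x b - x a - (b - a) *\<^sub>R G (x t)) \<le> e * (b - a)"
      if ab: "0 \<le> a" "a \<le> b" "a \<le> t" "t \<le> b" "b - a < d" for a b
    proof -
      have lenlim: "(\<lambda>n. real (N (r n) b - N (r n) a) * h (r n)) \<longlonglongrightarrow> b - a"
      proof (rule tendsto_sandwich)
        have "b - a - h (r n) \<le> real (N (r n) b - N (r n) a) * h (r n)
            \<and> real (N (r n) b - N (r n) a) * h (r n) \<le> b - a + h (r n)" for n
          using Nle[of b "r n"] Nle[of a "r n"] Nge[of a "r n"] Nge[of b "r n"] ab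
            Nmono[of a b "r n"] by (simp add: of_nat_diff algebra_simps)
        then show "\<forall>\<^sub>F n in sequentially. b - a - h (r n) \<le> real (N (r n) b - N (r n) a) * h (r n)"
          "\<forall>\<^sub>F n in sequentially. real (N (r n) b - N (r n) a) * h (r n) \<le> b - a + h (r n)"
          by auto
        show "(\<lambda>n. b - a - h (r n)) \<longlonglongrightarrow> b - a" using tendsto_diff[OF tendsto_const hr] by simp
        show "(\<lambda>n. b - a + h (r n)) \<longlonglongrightarrow> b - a" using tendsto_add[OF tendsto_const hr] by simp
      qed
      have "\<forall>\<^sub>F n in sequentially. h (r n) < d" using hr d(1) order_tendstoD(2) by blast
      moreover have "\<forall>\<^sub>F n in sequentially. norm (y (r n) t - x t) < \<delta> / 2"
        using x[OF t] \<delta>(1) unfolding tendsto_iff dist_norm by (meson half_gt_zero)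
      ultimately have ev: "\<forall>\<^sub>F n in sequentially.
          norm (y (r n) b - y (r n) a - (real (N (r n) b - N (r n) a) * h (r n)) *\<^sub>R G (x t))
          \<le> real (N (r n) b - N (r n) a) * h (r n) * e"
      proof eventually_elim
        case (elim n)
        let ?n = "r n"
        have slope: "norm (G (z ?n k) - G (x t)) \<le> e" if k: "N ?n a \<le> k" "k < N ?n b" for k
        proof (rule \<delta>(2))
          have len: "real (N ?n b - N ?n a) * h ?n \<le> b - a + h ?n"
            using Nle[of b ?n] Nge[of a ?n] ab Nmono[of a b ?n]
            by (simp add: of_nat_diff algebra_simps)
          have Nt: "N ?n a \<le> N ?n t" "N ?n t \<le> N ?n b" using Nmono ab by blast+
          have "norm (z ?n k - z ?n (N ?n t)) \<le> real (N ?n b - N ?n a) * h ?n * C"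
          proof (cases "k \<le> N ?n t")
            case True
            then have "norm (z ?n k - z ?n (N ?n t)) \<le> real (N ?n t - k) * h ?n * C"
              using zlip[of k "N ?n t" ?n] by (simp add: norm_minus_commute)
            also have "\<dots> \<le> real (N ?n b - N ?n a) * h ?n * C"
              using Nt k True C0 h0[of ?n] by (intro mult_right_mono) auto
            finally show ?thesis .
          next
            case False
            then have "norm (z ?n k - z ?n (N ?n t)) \<le> real (k - N ?n t) * h ?n * C"
              using zlip[of "N ?n t" k ?n] by simp
            also have "\<dots> \<le> real (N ?n b - N ?n a) * h ?n * C"
              using Nt k False C0 h0[of ?n] by (intro mult_right_mono) auto
            finally show ?thesis .
          qed
          also have "\<dots> \<le> (d + d) * C"
            using len ab elim C0 by (intro mult_right_mono) auto
          also have "\<dots> \<le> \<delta> / 2" using d(2) by (simp add: algebra_simps)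
          finally have "norm (z ?n k - y ?n t) \<le> \<delta> / 2" by (simp add: y_def)
          then show "norm (z ?n k - x t) < \<delta>"
            using elim norm_triangle_ineq[of "z ?n k - y ?n t" "y ?n t - x t"] by simp
        qed
        show ?case
          unfolding y_def z_def
          using euler_increment[OF less_imp_le[OF h0] Nmono[OF ab(2)]] slope
          by (metis z_def)
      qed
      have "norm (x b - x a - (b - a) *\<^sub>R G (x t)) \<le> (b - a) * e"
        by (rule tendsto_le[OF _ _ _ ev]) (use ab in \<open>auto intro!: tendsto_intros lenlim x\<close>)
      then show ?thesis by (simp add: mult.commute)
    qed
    show "\<exists>d>0. \<forall>s\<in>{0..}. norm (s - t) < d \<longrightarrow>
        norm (x s - x t - (s - t) *\<^sub>R G (x t)) \<le> e * norm (s - t)"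
    proof (intro exI[of _ d] conjI ballI impI)
      fix s assume s: "s \<in> {0..}" "norm (s - t) < d"
      show "norm (x s - x t - (s - t) *\<^sub>R G (x t)) \<le> e * norm (s - t)"
      proof (cases "t \<le> s")
        case True
        then show ?thesis using incr[of t s] s t by simp
      next
        case False
        have "x s - x t - (s - t) *\<^sub>R G (x t) = - (x t - x s - (t - s) *\<^sub>R G (x t))"
          by (simp add: algebra_simps)
        then have "norm (x s - x t - (s - t) *\<^sub>R G (x t)) = norm (x t - x s - (t - s) *\<^sub>R G (x t))"
          by (metis norm_minus_cancel)
        then show ?thesis using incr[of s t] s False by simp
      qed
    qed (rule d(1))
  qed
  ultimately show ?thesis by blast
qed

section \<open>Real functions on a half-line\<close>

lemma eventually_bounded_mono_converges:
  fixes f :: "real \<Rightarrow> real"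
  assumes mono: "\<And>s t. 0 \<le> s \<Longrightarrow> s \<le> t \<Longrightarrow> f s \<le> f t"
    and bdd: "\<forall>\<^sub>F t in at_top. f t \<le> C"
  obtains L where "(f \<longlongrightarrow> L) at_top" "\<And>t. 0 \<le> t \<Longrightarrow> f t \<le> L"
proof -
  obtain N where N: "\<And>t. N \<le> t \<Longrightarrow> f t \<le> C"
    using bdd unfolding eventually_at_top_linorder by blast
  have le: "f t \<le> C" if "0 \<le> t" for t
    using mono[OF that, of "max N t"] N[of "max N t"] by simp
  define L where "L = Sup (f ` {0..})"
  have bddS: "bdd_above (f ` {0..})" using le by (intro bdd_aboveI[of _ C]) auto
  have upper: "f t \<le> L" if "0 \<le> t" for t
    unfolding L_def using that bddS by (intro cSup_upper) auto
  have "(f \<longlongrightarrow> L) at_top"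
  proof (rule increasing_tendsto)
    show "\<forall>\<^sub>F t in at_top. f t \<le> L"
      using eventually_ge_at_top[of 0] by eventually_elim (rule upper)
    fix y assume "y < L"
    then obtain s where s: "0 \<le> s" "y < f s"
      unfolding L_def using less_cSup_iff[OF _ bddS] by auto
    show "\<forall>\<^sub>F t in at_top. y < f t"
      using eventually_ge_at_top[of s] by eventually_elim (use s mono less_le_trans in blast)
  qed
  with upper show ?thesis using that by blast
qed

text \<open>
  A derivative that stays above \<open>l / 2 > 0\<close> would keep the increments over unit time above
  \<open>l / 2\<close>, whereas the increments of a convergent function tend to \<open>0\<close>.
\<close>

lemma convergent_derivative_limit_nonpos:
  fixes f :: "real \<Rightarrow> real"
  assumes lim: "(f \<longlongrightarrow> L) at_top" and lim': "(f' \<longlongrightarrow> l) at_top"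
    and der: "\<forall>\<^sub>F t in at_top. (f has_real_derivative f' t) (at t)"
  shows "l \<le> 0"
proof (rule ccontr)
  assume "\<not> l \<le> 0"
  then have "l / 2 < l" by simp
  then have "\<forall>\<^sub>F t in at_top. l / 2 < f' t" using lim' order_tendstoD(1) by blast
  then have "\<forall>\<^sub>F t in at_top. l / 2 < f' t \<and> (f has_real_derivative f' t) (at t)"
    using der by (rule eventually_conj)
  then obtain N where N: "\<And>t. N \<le> t \<Longrightarrow> l / 2 < f' t \<and> (f has_real_derivative f' t) (at t)"
    unfolding eventually_at_top_linorder by blast
  have step: "l / 2 \<le> f (t + 1) - f t" if "N \<le> t" for t
  proof -
    have "\<exists>z>t. z < t + 1 \<and> f (t + 1) - f t = (t + 1 - t) * f' z"
      by (rule MVT2) (use N that in auto)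
    then obtain z where "t < z" "f (t + 1) - f t = (t + 1 - t) * f' z" by blast
    then show ?thesis using N[of z] that by simp
  qed
  have "filterlim (\<lambda>t::real. t + 1) at_top at_top"
    by (rule filterlim_at_top_mono[OF filterlim_ident]) auto
  then have "((\<lambda>t. f (t + 1)) \<longlongrightarrow> L) at_top" by (rule filterlim_compose[OF lim])
  from tendsto_diff[OF this lim] have "((\<lambda>t. f (t + 1) - f t) \<longlongrightarrow> 0) at_top" by simp
  then have "l / 2 \<le> 0"
    by (rule tendsto_lowerbound) (use step in \<open>auto simp: eventually_at_top_linorder\<close>)
  then show False using \<open>\<not> l \<le> 0\<close> by simp
qed

text \<open>
  The times with nonpositive value form a compact set; its least element is the zero wanted.
\<close>

lemma first_zero:
  fixes f :: "real \<Rightarrow> real"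
  assumes cont: "continuous_on {a..b} f" and "0 < f a" "f b \<le> 0" "a \<le> b"
  obtains T where "a < T" "T \<le> b" "f T = 0" "\<And>r. a \<le> r \<Longrightarrow> r < T \<Longrightarrow> 0 < f r"
proof -
  define S where "S = {a..b} \<inter> f -` {..0}"
  have "closed S" unfolding S_def by (intro continuous_closed_preimage cont) auto
  moreover have "bounded S" unfolding S_def by (rule bounded_subset[OF bounded_closed_interval]) auto
  ultimately have "compact S" by (simp add: compact_eq_bounded_closed)
  moreover have "S \<noteq> {}" using assms by (force simp: S_def)
  ultimately have "\<exists>T\<in>S. \<forall>r\<in>S. T \<le> r" by (rule compact_attains_inf)
  then obtain T where T: "T \<in> S" "\<And>r. r \<in> S \<Longrightarrow> T \<le> r" by blast
  have aT: "a < T" and Tb: "T \<le> b" using T(1) assms(2) by (auto simp: S_def less_le)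
  have before: "0 < f r" if "a \<le> r" "r < T" for r
    using T(2)[of r] that Tb by (force simp: S_def)
  have "continuous_on {a..T} f" using cont Tb by (auto intro: continuous_on_subset)
  moreover have "f T \<le> 0" using T(1) by (simp add: S_def)
  ultimately obtain r where "a \<le> r" "r \<le> T" "f r = 0"
    using IVT2'[of f T 0 a] assms(2) aT by auto
  then have "f T = 0" using before[of r] by (cases "r = T") auto
  with aT Tb before show ?thesis using that by blast
qed

section \<open>The shape of the potential\<close>

locale isosceles_potential =
  fixes M \<mu> B B1 :: real
  assumes M_pos: "0 < M" and B_pos: "0 < B" and B1_pos: "0 < B1"
    and mu_large: "1 + B / (16 * B1) < \<mu>"
begin

abbreviation "\<kappa> \<equiv> (M / 2) powr (3/2)"
abbreviation "tw \<equiv> theta_w \<mu> (16 * B1 / B)"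
abbreviation "Uf \<equiv> U M \<mu> B B1"
abbreviation "Wf \<equiv> W M \<mu> B B1"

definition denom :: "real \<Rightarrow> real" where "denom \<theta> = (cos \<theta>)\<^sup>2 + \<mu> * (sin \<theta>)\<^sup>2"
text \<open>
  The critical ratio: \<open>W'\<close> changes sign where \<open>denom \<theta> = lam * cos\<^sup>2 \<theta>\<close>, and \<open>\<theta>\<^sub>w\<close> is the
  positive angle with this property.
\<close>

definition lam :: real where "lam = ((\<mu> - 1) * (16 * B1 / B)) powr (2/5)"

lemma kappa_pos: "0 < \<kappa>" using M_pos by simp

lemma mu_gt_1: "1 < \<mu>"
  using mu_large B_pos B1_pos by (smt (verit) divide_pos_pos)

lemma excess_gt_1: "1 < (\<mu> - 1) * (16 * B1 / B)"
proof -
  have "B / (16 * B1) < \<mu> - 1" using mu_large by simp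
  then show ?thesis using B_pos B1_pos by (simp add: field_simps)
qed

lemma lam_gt_1: "1 < lam"
  unfolding lam_def using excess_gt_1 by (simp add: gr_one_powr)

lemma denom_cos: "denom \<theta> = \<mu> - (\<mu> - 1) * (cos \<theta>)\<^sup>2"
  by (simp add: denom_def sin_squared_eq algebra_simps)

lemma denom_pos: "0 < denom \<theta>"
proof -
  have "(\<mu> - 1) * (cos \<theta>)\<^sup>2 \<le> (\<mu> - 1) * 1"
    using mu_gt_1 abs_cos_le_one[of \<theta>] by (intro mult_left_mono) (auto simp: abs_square_le_1)
  then show ?thesis by (simp add: denom_cos)
qed

lemma cos_theta_w: "(cos tw)\<^sup>2 = \<mu> / ((\<mu> - 1) + lam)" "0 < tw" "tw < pi / 2"
proof -
  let ?q = "\<mu> / ((\<mu> - 1) + lam)"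
  have q: "0 < ?q" "?q < 1" using mu_gt_1 lam_gt_1 by auto
  have lam: "(\<mu> - 1) powr (2/5) * (16 * B1 / B) powr (2/5) = lam"
    unfolding lam_def using mu_gt_1 B1_pos B_pos by (subst powr_mult) auto
  have tw: "tw = arccos (sqrt ?q)" by (simp add: theta_w_def lam)
  have s: "0 < sqrt ?q" "sqrt ?q < 1" using q by (simp_all only: real_sqrt_gt_0_iff real_sqrt_lt_1_iff)
  have s': "-1 \<le> sqrt ?q" using s by linarith
  have "cos tw = sqrt ?q" unfolding tw using s s' by (intro cos_arccos) auto
  then show "(cos tw)\<^sup>2 = ?q" using q by simp
  show "0 < tw" unfolding tw using s s' arccos_less_arccos[of "sqrt ?q" 1] by auto
  show "tw < pi / 2" unfolding tw using s s' arccos_less_arccos[of 0 "sqrt ?q"] by auto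
qed

lemma cos_tw_pos: "0 < cos tw"
  using cos_theta_w cos_gt_zero_pi by force

text \<open>
  Both sides are affine in \<open>cos\<^sup>2 \<theta>\<close> and vanish at \<open>\<theta>\<^sub>w\<close>; so the sign of the left-hand side is
  decided by comparing \<open>\<theta>\<close> with \<open>\<theta>\<^sub>w\<close>.
\<close>

lemma denom_minus_lam: "denom \<theta> - lam * (cos \<theta>)\<^sup>2 = ((\<mu> - 1) + lam) * ((cos tw)\<^sup>2 - (cos \<theta>)\<^sup>2)"
  using cos_theta_w(1) mu_gt_1 lam_gt_1 by (simp add: denom_cos field_simps)

lemma U_pos: "0 \<le> cos \<theta> \<Longrightarrow> 0 < Uf \<theta>"
  unfolding U_def using kappa_pos B_pos B1_pos
  by (intro mult_pos_pos add_pos_nonneg divide_nonneg_nonneg mult_nonneg_nonneg) auto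

lemma W_pos: "0 < cos \<theta> \<Longrightarrow> 0 < Wf \<theta>"
  unfolding W_def using kappa_pos B_pos B1_pos
  by (intro mult_pos_pos add_pos_nonneg divide_nonneg_nonneg mult_nonneg_nonneg) auto

lemma W_abs: "Wf \<bar>\<theta>\<bar> = Wf \<theta>"
  by (cases "0 \<le> \<theta>") (simp_all add: W_def)

lemma denom_powr_deriv:
  "((\<lambda>\<theta>. denom \<theta> powr a) has_real_derivative
     2 * a * (\<mu> - 1) * sin \<theta> * cos \<theta> * denom \<theta> powr (a - 1)) (at \<theta>)"
proof -
  have "(denom has_real_derivative 2 * (\<mu> - 1) * sin \<theta> * cos \<theta>) (at \<theta>)"
    unfolding denom_def [abs_def] by (auto intro!: derivative_eq_intros simp: algebra_simps)
  from DERIV_fun_powr[OF this denom_pos, of a] show ?thesis by (simp add: mult_ac)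
qed

lemma denom_powr_minus_three_halves:
  "denom \<theta> powr (-3/2) = inverse (((cos \<theta>)\<^sup>2 + \<mu> * (sin \<theta>)\<^sup>2) powr (3/2))"
  using powr_minus[of "denom \<theta>" "3/2"] unfolding denom_def by simp

lemma U_alt: "Uf \<theta> = \<kappa> * (B + 16 * B1 * cos \<theta> ^ 3 * denom \<theta> powr (-3/2))"
  by (simp only: U_def denom_powr_minus_three_halves divide_inverse[of _ "_ powr _"])

lemma W_alt: "Wf \<theta> = \<kappa> * (B * inverse (cos \<theta> ^ 3) + 16 * B1 * denom \<theta> powr (-3/2))"
  by (simp only: W_def denom_powr_minus_three_halves divide_inverse[of _ "_ powr _"] divide_inverse[of B])

text \<open>
  The closed form is free of cosines in denominators, and so shows that the derivative is
  continuous up to the collision angles.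
\<close>

lemma U_deriv:
  "(Uf has_real_derivative - (48 * \<kappa> * B1 * \<mu> * (cos \<theta>)\<^sup>2 * sin \<theta> * denom \<theta> powr (-5/2))) (at \<theta>)"
proof -
  have pw: "denom \<theta> powr (-3/2) = denom \<theta> * denom \<theta> powr (-5/2)"
    using powr_add[of "denom \<theta>" 1 "-5/2"] denom_pos[of \<theta>] by simp
  have "((\<lambda>\<theta>. cos \<theta> ^ 3) has_real_derivative - (3 * (cos \<theta>)\<^sup>2 * sin \<theta>)) (at \<theta>)"
    by (auto intro!: derivative_eq_intros)
  moreover have "((\<lambda>\<theta>. denom \<theta> powr (-3/2)) has_real_derivative
      - (3 * (\<mu> - 1) * sin \<theta> * cos \<theta> * denom \<theta> powr (-5/2))) (at \<theta>)"
    using denom_powr_deriv[of "-3/2" \<theta>] by (simp add: algebra_simps)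
  ultimately have "((\<lambda>\<theta>. cos \<theta> ^ 3 * denom \<theta> powr (-3/2)) has_real_derivative
      (- (3 * (cos \<theta>)\<^sup>2 * sin \<theta>) * denom \<theta> powr (-3/2)
       + - (3 * (\<mu> - 1) * sin \<theta> * cos \<theta> * denom \<theta> powr (-5/2)) * cos \<theta> ^ 3)) (at \<theta>)"
    by (rule DERIV_mult)
  from DERIV_cmult[OF DERIV_add[OF DERIV_const[of B] DERIV_cmult[OF this, of "16 * B1"]], of \<kappa>]
  have "(Uf has_real_derivative \<kappa> * (0 + 16 * B1 *
      (- (3 * (cos \<theta>)\<^sup>2 * sin \<theta>) * denom \<theta> powr (-3/2)
       + - (3 * (\<mu> - 1) * sin \<theta> * cos \<theta> * denom \<theta> powr (-5/2)) * cos \<theta> ^ 3))) (at \<theta>)"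
    by (simp only: U_alt[abs_def] mult.assoc)
  also have "\<kappa> * (0 + 16 * B1 * (- (3 * (cos \<theta>)\<^sup>2 * sin \<theta>) * denom \<theta> powr (-3/2)
       + - (3 * (\<mu> - 1) * sin \<theta> * cos \<theta> * denom \<theta> powr (-5/2)) * cos \<theta> ^ 3))
      = - (48 * \<kappa> * B1 * (cos \<theta>)\<^sup>2 * sin \<theta> * denom \<theta> powr (-5/2) * (denom \<theta> + (\<mu> - 1) * (cos \<theta>)\<^sup>2))"
    unfolding pw by (simp add: algebra_simps power2_eq_square power3_eq_cube)
  finally show ?thesis by (simp add: denom_cos mult_ac)
qed

lemma isCont_U: "isCont Uf \<theta>"
  using U_deriv DERIV_isCont by blast

lemma isCont_deriv_U: "isCont (deriv Uf) \<theta>"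
proof -
  have "deriv Uf = (\<lambda>\<theta>. - (48 * \<kappa> * B1 * \<mu> * (cos \<theta>)\<^sup>2 * sin \<theta> * denom \<theta> powr (-5/2)))"
    using U_deriv DERIV_imp_deriv by blast
  moreover have "isCont (\<lambda>\<theta>. denom \<theta> powr (-5/2)) \<theta>" using denom_powr_deriv DERIV_isCont by blast
  ultimately show ?thesis by (auto intro!: continuous_intros)
qed

lemma W_deriv:
  assumes "0 < cos \<theta>"
  shows "(Wf has_real_derivative 3 * \<kappa> * sin \<theta> / cos \<theta> ^ 4 *
      (B - 16 * B1 * (\<mu> - 1) * cos \<theta> ^ 5 * denom \<theta> powr (-5/2))) (at \<theta>)"
proof -
  let ?c = "cos \<theta>" and ?s = "sin \<theta>" and ?P = "denom \<theta> powr (-5/2)"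
  have e1: "inverse (?c ^ 3) * (3 * ?c\<^sup>2 * (- ?s)) * inverse (?c ^ 3) = - (3 * ?s / ?c ^ 4)"
    using assms by (simp add: divide_simps)
  have e2: "?c ^ 5 / ?c ^ 4 = ?c"
    using assms by (simp add: divide_simps) (simp add: eval_nat_numeral)
  have "((\<lambda>\<theta>. inverse (cos \<theta> ^ 3)) has_real_derivative
      - (inverse (?c ^ 3) * (3 * ?c\<^sup>2 * (- ?s)) * inverse (?c ^ 3))) (at \<theta>)"
    using assms by (auto intro!: derivative_eq_intros)
  then have "((\<lambda>\<theta>. inverse (cos \<theta> ^ 3)) has_real_derivative 3 * ?s / ?c ^ 4) (at \<theta>)"
    unfolding e1 by simp
  moreover have "((\<lambda>\<theta>. denom \<theta> powr (-3/2)) has_real_derivative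
      - (3 * (\<mu> - 1) * ?s * ?c * ?P)) (at \<theta>)"
    using denom_powr_deriv[of "-3/2" \<theta>] by (simp add: algebra_simps)
  ultimately have "(Wf has_real_derivative \<kappa> * (B * (3 * ?s / ?c ^ 4)
      + 16 * B1 * - (3 * (\<mu> - 1) * ?s * ?c * ?P))) (at \<theta>)"
    by (simp only: W_alt[abs_def] DERIV_cmult DERIV_add)
  moreover have "3 * \<kappa> * ?s / ?c ^ 4 * (B - 16 * B1 * (\<mu> - 1) * ?c ^ 5 * ?P)
      = \<kappa> * (B * (3 * ?s / ?c ^ 4) + 16 * B1 * - (3 * (\<mu> - 1) * ?s * (?c ^ 5 / ?c ^ 4) * ?P))"
    by (simp add: algebra_simps add_divide_distrib diff_divide_distrib)
  ultimately show ?thesis by (simp only: e2)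
qed

lemma lam_powr: "lam powr (5/2) = (\<mu> - 1) * (16 * B1 / B)"
proof -
  have "(E powr (2/5)) powr (5/2) = E" if "0 < E" for E :: real
    using that by (simp add: powr_powr)
  then show ?thesis unfolding lam_def using excess_gt_1 by force
qed

lemma critical_power:
  assumes "0 < cos \<theta>"
  shows "(lam * (cos \<theta>)\<^sup>2) powr (5/2) = (\<mu> - 1) * (16 * B1 / B) * cos \<theta> ^ 5"
proof -
  have "((cos \<theta>)\<^sup>2) powr (5/2) = cos \<theta> ^ 5"
    using assms by (simp add: powr_powr flip: powr_numeral)
  then show ?thesis using lam_gt_1 by (simp add: powr_mult lam_powr)
qed

text \<open>
  Rewrites the last factor of \<open>W'\<close> as a difference of powers, so that its sign is the
  sign of \<open>denom \<theta> - lam * cos\<^sup>2 \<theta>\<close>.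
\<close>

lemma W_deriv_factor:
  assumes "0 < cos \<theta>"
  shows "B - 16 * B1 * (\<mu> - 1) * cos \<theta> ^ 5 * denom \<theta> powr (-5/2)
    = B * denom \<theta> powr (-5/2) * (denom \<theta> powr (5/2) - (lam * (cos \<theta>)\<^sup>2) powr (5/2))"
proof -
  have one: "denom \<theta> powr (-5/2) * denom \<theta> powr (5/2) = 1"
    using denom_pos[of \<theta>] by (simp flip: powr_add)
  have "B * denom \<theta> powr (-5/2) * (denom \<theta> powr (5/2) - E)
      = B * (denom \<theta> powr (-5/2) * denom \<theta> powr (5/2)) - B * E * denom \<theta> powr (-5/2)" for E
    by (simp only: right_diff_distrib mult_ac)
  moreover have "B * ((\<mu> - 1) * (16 * B1 / B) * cos \<theta> ^ 5) = 16 * B1 * (\<mu> - 1) * cos \<theta> ^ 5"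
    using B_pos by simp
  ultimately show ?thesis unfolding critical_power[OF assms] one by simp
qed

lemma W_increasing_beyond:
  assumes "tw < \<theta>" "\<theta> < pi / 2"
  shows "\<exists>d>0. (Wf has_real_derivative d) (at \<theta>)"
proof -
  have c: "0 < cos \<theta>" using assms cos_theta_w cos_gt_zero_pi by force
  have "cos \<theta> < cos tw" using assms cos_theta_w by (intro cos_monotone_0_pi) auto
  then have "(cos \<theta>)\<^sup>2 < (cos tw)\<^sup>2" using c by (intro power_strict_mono) auto
  then have "0 < denom \<theta> - lam * (cos \<theta>)\<^sup>2"
    unfolding denom_minus_lam using mu_gt_1 lam_gt_1 by simp
  then have "(lam * (cos \<theta>)\<^sup>2) powr (5/2) < denom \<theta> powr (5/2)"
    using lam_gt_1 by (intro powr_less_mono2) auto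
  moreover have "0 < sin \<theta>" using assms cos_theta_w by (intro sin_gt_zero) auto
  ultimately have "0 < 3 * \<kappa> * sin \<theta> / cos \<theta> ^ 4 *
      (B - 16 * B1 * (\<mu> - 1) * cos \<theta> ^ 5 * denom \<theta> powr (-5/2))"
    unfolding W_deriv_factor[OF c] using B_pos M_pos denom_pos[of \<theta>] c by simp
  with W_deriv[OF c] show ?thesis by blast
qed

lemma W_decreasing_before:
  assumes "0 \<le> \<theta>" "\<theta> \<le> tw"
  shows "\<exists>d\<le>0. (Wf has_real_derivative d) (at \<theta>)"
proof -
  have c: "0 < cos \<theta>" using assms cos_theta_w cos_gt_zero_pi by force
  have "cos tw \<le> cos \<theta>" using assms cos_theta_w by (intro cos_monotone_0_pi_le) auto
  then have "(cos tw)\<^sup>2 \<le> (cos \<theta>)\<^sup>2" using cos_tw_pos by (intro power_mono) auto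
  then have "denom \<theta> - lam * (cos \<theta>)\<^sup>2 \<le> 0"
    unfolding denom_minus_lam using mu_gt_1 lam_gt_1 by (simp add: mult_le_0_iff)
  then have "denom \<theta> powr (5/2) \<le> (lam * (cos \<theta>)\<^sup>2) powr (5/2)"
    using denom_pos[of \<theta>] by (intro powr_mono2) auto
  moreover have "0 \<le> sin \<theta>" using assms cos_theta_w by (intro sin_ge_zero) auto
  ultimately have "3 * \<kappa> * sin \<theta> / cos \<theta> ^ 4 *
      (B - 16 * B1 * (\<mu> - 1) * cos \<theta> ^ 5 * denom \<theta> powr (-5/2)) \<le> 0"
    unfolding W_deriv_factor[OF c] using B_pos M_pos denom_pos[of \<theta>] c
    by (intro mult_nonneg_nonpos divide_nonneg_nonneg mult_nonneg_nonneg) auto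
  with W_deriv[OF c] show ?thesis by blast
qed

lemma W_decreasing_on:
  assumes "0 \<le> a" "a \<le> b" "b \<le> tw"
  shows "Wf b \<le> Wf a"
proof (rule DERIV_nonpos_imp_nonincreasing[OF \<open>a \<le> b\<close>])
  fix x assume "a \<le> x" "x \<le> b"
  then show "\<exists>y. (Wf has_real_derivative y) (at x) \<and> y \<le> 0"
    using W_decreasing_before[of x] assms by force
qed

lemma W_le_W0:
  assumes "\<bar>\<theta>\<bar> \<le> tw"
  shows "Wf \<theta> \<le> Wf 0"
  using W_decreasing_on[of 0 "\<bar>\<theta>\<bar>"] assms by (simp add: W_abs)

lemma W_ge_Wtw:
  assumes "\<bar>\<theta>\<bar> < pi / 2"
  shows "Wf tw \<le> Wf \<theta>"
proof -
  have "Wf tw \<le> Wf \<bar>\<theta>\<bar>"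
  proof (cases "\<bar>\<theta>\<bar> \<le> tw")
    case True
    then show ?thesis using W_decreasing_on[of "\<bar>\<theta>\<bar>" tw] by simp
  next
    case False
    have "isCont Wf x" if "tw \<le> x" "x \<le> \<bar>\<theta>\<bar>" for x
    proof -
      have "0 < cos x" using that assms cos_theta_w by (intro cos_gt_zero_pi) auto
      from W_deriv[OF this] show ?thesis by (rule DERIV_isCont)
    qed
    then have cont: "continuous_on {tw..\<bar>\<theta>\<bar>} Wf"
      by (intro continuous_at_imp_continuous_on ballI) auto
    show ?thesis
    proof (rule DERIV_nonneg_imp_increasing_open[OF _ _ cont])
      fix x assume "tw < x" "x < \<bar>\<theta>\<bar>"
      then obtain d where "0 < d" "(Wf has_real_derivative d) (at x)"
        using W_increasing_beyond[of x] assms by auto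
      then show "\<exists>y. (Wf has_real_derivative y) (at x) \<and> 0 \<le> y" by (auto intro!: exI[of _ d])
    qed (use False in linarith)
  qed
  then show ?thesis by (simp only: W_abs)
qed

lemma W_0: "Wf 0 = \<kappa> * B * (1 + 16 * B1 / B)"
  using B_pos by (simp add: W_def algebra_simps)

text \<open>
  At \<open>\<theta>\<^sub>w\<close> the denominator is \<open>lam * cos\<^sup>2 \<theta>\<^sub>w\<close>, so both terms of \<open>W\<close> are multiples of
  \<open>cos\<^sup>-\<^sup>3 \<theta>\<^sub>w\<close>.
\<close>

lemma W_tw: "Wf tw = \<kappa> * B * (1 + lam / (\<mu> - 1)) / cos tw ^ 3"
proof -
  have "(cos tw) ^ 3 = ((cos tw)\<^sup>2) powr (3/2)"
    using cos_tw_pos by (simp add: powr_powr flip: powr_numeral)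
  moreover have "denom tw = lam * (cos tw)\<^sup>2" using denom_minus_lam[of tw] by simp
  ultimately have powr_eq: "denom tw powr (3/2) = lam powr (3/2) * cos tw ^ 3"
    using lam_gt_1 by (simp add: powr_mult)
  moreover have "16 * B1 / (lam powr (3/2) * x) = B * (lam / (\<mu> - 1)) / x" for x
  proof -
    have "lam * lam powr (3/2) = lam powr (5/2)"
      using lam_gt_1 powr_add[of lam 1 "3/2"] by simp
    then have "16 * B1 = B * (lam / (\<mu> - 1)) * lam powr (3/2)"
      using lam_powr B_pos mu_gt_1 by (simp add: field_simps)
    then show ?thesis using lam_gt_1 by simp
  qed
  ultimately show ?thesis
    using cos_tw_pos lam_gt_1 unfolding W_def denom_def[symmetric] powr_eq
    by (simp add: add_divide_distrib distrib_left)
qed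

section \<open>The vector field on the collision manifold\<close>

abbreviation "\<Delta> \<equiv> triple_collision_manifold M \<mu> B B1"
abbreviation "X \<equiv> schwarzschild_field M \<mu> B B1"
text \<open>
  \<open>Vm\<close> is the velocity at \<open>E\<^sub>-\<close>, and \<open>k\<close> bounds the rate of change of \<open>v\<close> with \<open>\<theta>\<close> between the two minima of \<open>W\<close>.
\<close>

abbreviation "Vm \<equiv> sqrt (2 * Wf tw)"
abbreviation "k \<equiv> sqrt (Wf 0 / 2)"

definition vel_rate :: "real \<Rightarrow> real \<Rightarrow> real" where
  "vel_rate v \<theta> = cos \<theta> ^ 3 / (2 * sqrt (Uf \<theta>)) * v\<^sup>2 - sqrt (Uf \<theta>)"

definition angvel_rate :: "real \<Rightarrow> real \<Rightarrow> real \<Rightarrow> real" where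
  "angvel_rate v \<theta> w = cos \<theta> ^ 3 / (2 * sqrt (Uf \<theta>)) * v * w
        + deriv Uf \<theta> / Uf \<theta> * (cos \<theta> ^ 3 - w\<^sup>2 / 2)
        - 3 * sin \<theta> * (cos \<theta>)\<^sup>2
        + 3 * sin \<theta> * cos \<theta> ^ 5 / Uf \<theta> * v\<^sup>2"

lemma X_eq: "X (v, \<theta>, w) = (vel_rate v \<theta>, w, angvel_rate v \<theta> w)"
  by (simp add: schwarzschild_field_def vel_rate_def angvel_rate_def)

lemma Delta_iff: "(v, \<theta>, w) \<in> \<Delta> \<longleftrightarrow> - (pi / 2) \<le> \<theta> \<and> \<theta> \<le> pi / 2 \<and>
    w\<^sup>2 + cos \<theta> ^ 6 / Uf \<theta> * v\<^sup>2 = 2 * cos \<theta> ^ 3"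
  by (simp add: triple_collision_manifold_def)

lemma Delta_cos_nonneg: "(v, \<theta>, w) \<in> \<Delta> \<Longrightarrow> 0 \<le> cos \<theta>"
  unfolding Delta_iff using cos_ge_zero[of \<theta>] by linarith

lemma Delta_w_le:
  assumes "(v, \<theta>, w) \<in> \<Delta>"
  shows "w\<^sup>2 \<le> 2 * cos \<theta> ^ 3"
proof -
  have "0 \<le> cos \<theta> ^ 6 / Uf \<theta> * v\<^sup>2" using U_pos[OF Delta_cos_nonneg[OF assms]] by simp
  then show ?thesis using assms unfolding Delta_iff by linarith
qed

lemma Delta_w_lt:
  assumes "(v, \<theta>, w) \<in> \<Delta>" "v \<noteq> 0" "0 < cos \<theta>"
  shows "w\<^sup>2 < 2 * cos \<theta> ^ 3"
proof -
  have "0 < cos \<theta> ^ 6 / Uf \<theta> * v\<^sup>2" using assms U_pos[of \<theta>] by simp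
  then show ?thesis using assms(1) unfolding Delta_iff by linarith
qed

lemma Delta_cos_pos:
  assumes "(v, \<theta>, w) \<in> \<Delta>" "w \<noteq> 0"
  shows "0 < cos \<theta>"
proof -
  have "0 < w\<^sup>2" using assms by simp
  also have "\<dots> \<le> 2 * cos \<theta> ^ 3" by (rule Delta_w_le[OF assms(1)])
  finally show ?thesis using Delta_cos_nonneg[OF assms(1)] by (cases "cos \<theta> = 0") auto
qed

text \<open>
  Eliminating \<open>v\<^sup>2\<close> through the energy relation exhibits the sign of \<open>v'\<close>.
\<close>

lemma vel_rate_on_Delta:
  assumes "(v, \<theta>, w) \<in> \<Delta>" "0 < cos \<theta>"
  shows "vel_rate v \<theta> = - (sqrt (Uf \<theta>) * w\<^sup>2 / (2 * cos \<theta> ^ 3))"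
proof -
  define u c where "u = sqrt (Uf \<theta>)" and "c = cos \<theta>"
  have u: "0 < u" "Uf \<theta> = u\<^sup>2" using U_pos[of \<theta>] assms(2) by (auto simp: u_def)
  have c: "0 < c" using assms by (simp add: c_def)
  have "w\<^sup>2 = 2 * c ^ 3 - c ^ 6 / u\<^sup>2 * v\<^sup>2" using assms(1) by (simp add: Delta_iff c_def u(2))
  moreover have "c ^ 3 / (2 * u) * v\<^sup>2 - u = - (u * (2 * c ^ 3 - c ^ 6 / u\<^sup>2 * v\<^sup>2) / (2 * c ^ 3))"
  proof -
    have "c ^ 6 = c ^ 3 * c ^ 3" by (simp flip: power_add)
    then show ?thesis using c u(1) by (simp add: field_simps power2_eq_square)
  qed
  ultimately show ?thesis by (simp add: vel_rate_def c_def u_def)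
qed

lemma vel_rate_nonpos:
  assumes "(v, \<theta>, w) \<in> \<Delta>"
  shows "vel_rate v \<theta> \<le> 0"
proof (cases "cos \<theta> = 0")
  case True
  then show ?thesis using U_pos[of \<theta>] by (simp add: vel_rate_def)
next
  case False
  then have "0 < cos \<theta>" using Delta_cos_nonneg[OF assms] by simp
  then show ?thesis unfolding vel_rate_on_Delta[OF assms \<open>0 < cos \<theta>\<close>] using U_pos[of \<theta>] by simp
qed

lemma cos_pos_within_tw: "\<bar>\<theta>\<bar> \<le> tw \<Longrightarrow> 0 < cos \<theta>"
  using cos_theta_w by (intro cos_gt_zero_pi) auto

text \<open>
  The estimate \<open>dv/d\<theta> \<ge> - k\<close>, multiplied by \<open>\<theta>' = w\<close>. It compares squares, using
  \<open>w\<^sup>2 \<le> 2 cos\<^sup>3 \<theta>\<close> and \<open>U \<le> W(0) cos\<^sup>3 \<theta>\<close>; the first is strict unless \<open>v = 0\<close>.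
\<close>

lemma drift:
  assumes mem: "(v, \<theta>, w) \<in> \<Delta>" and th: "\<bar>\<theta>\<bar> \<le> tw" and w: "0 \<le> w"
  shows "0 \<le> vel_rate v \<theta> + k * w" and "0 < w \<Longrightarrow> v \<noteq> 0 \<Longrightarrow> 0 < vel_rate v \<theta> + k * w"
proof -
  define C where "C = cos \<theta> ^ 3"
  have c: "0 < cos \<theta>" and C: "0 < C" using cos_pos_within_tw[OF th] by (auto simp: C_def)
  have UC: "Uf \<theta> = Wf \<theta> * C" using U_eq_W_cos3[of \<theta>] c by (simp add: C_def)
  have W0: "0 < Wf 0" by (intro W_pos) simp
  have k2: "(2 * C * k)\<^sup>2 = 2 * C * (Wf 0 * C)"
  proof -
    have "k\<^sup>2 = Wf 0 / 2" using W0 by simp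
    then have "(2 * C * k)\<^sup>2 = (2 * C)\<^sup>2 * (Wf 0 / 2)" by (simp only: power_mult_distrib)
    then show ?thesis by (simp add: power2_eq_square)
  qed
  have le: "Wf \<theta> * C \<le> Wf 0 * C" using W_le_W0[OF th] C by simp
  have sq: "(w * sqrt (Uf \<theta>))\<^sup>2 = w\<^sup>2 * (Wf \<theta> * C)"
  proof -
    have "(sqrt (Uf \<theta>))\<^sup>2 = Uf \<theta>" using U_pos[of \<theta>] c by simp
    then show ?thesis by (simp only: power_mult_distrib UC)
  qed
  have wC: "w\<^sup>2 \<le> 2 * C" using Delta_w_le[OF mem] by (simp add: C_def)
  have WC: "0 < Wf \<theta> * C" using W_pos[OF c] C by (rule mult_pos_pos)
  have Ck: "0 \<le> 2 * C * k" using C W0 by (intro mult_nonneg_nonneg) simp_all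
  have V: "vel_rate v \<theta> + k * w = w / (2 * C) * (2 * C * k - w * sqrt (Uf \<theta>))"
    unfolding vel_rate_on_Delta[OF mem c] C_def[symmetric] using C
    by (simp add: right_diff_distrib power2_eq_square)
  have "(w * sqrt (Uf \<theta>))\<^sup>2 \<le> (2 * C * k)\<^sup>2"
    unfolding sq k2
    by (rule mult_mono[OF wC le]) (use WC C in simp_all)
  then have "w * sqrt (Uf \<theta>) \<le> 2 * C * k"
    by (rule power2_le_imp_le[OF _ Ck])
  then show "0 \<le> vel_rate v \<theta> + k * w" unfolding V using w C by simp
  assume w: "0 < w" and "v \<noteq> 0"
  have "(w * sqrt (Uf \<theta>))\<^sup>2 < (2 * C * k)\<^sup>2"
    unfolding sq k2
    by (rule mult_less_le_imp_less[OF Delta_w_lt[OF mem \<open>v \<noteq> 0\<close> c, folded C_def] le])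
      (use WC in simp_all)
  then have "w * sqrt (Uf \<theta>) < 2 * C * k"
    by (rule power2_less_imp_less[OF _ Ck])
  then show "0 < vel_rate v \<theta> + k * w" unfolding V using w C by simp
qed

lemma deriv_U_from_W:
  assumes "0 < cos \<theta>" and W': "(Wf has_real_derivative d) (at \<theta>)"
  shows "deriv Uf \<theta> = d * cos \<theta> ^ 3 - 3 * (cos \<theta>)\<^sup>2 * sin \<theta> * Wf \<theta>"
proof -
  have "((\<lambda>\<theta>. cos \<theta> ^ 3) has_real_derivative - (3 * (cos \<theta>)\<^sup>2 * sin \<theta>)) (at \<theta>)"
    by (auto intro!: derivative_eq_intros)
  from DERIV_mult[OF W' this]
  have "((\<lambda>\<theta>. Wf \<theta> * cos \<theta> ^ 3) has_real_derivative
      d * cos \<theta> ^ 3 - 3 * (cos \<theta>)\<^sup>2 * sin \<theta> * Wf \<theta>) (at \<theta>)" by simp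
  moreover have "open {x::real. 0 < cos x}"
    by (intro open_Collect_less continuous_intros)
  ultimately have "(Uf has_real_derivative
      d * cos \<theta> ^ 3 - 3 * (cos \<theta>)\<^sup>2 * sin \<theta> * Wf \<theta>) (at \<theta>)"
    by (rule has_field_derivative_transform_within_open) (use assms U_eq_W_cos3 in auto)
  then show ?thesis by (rule DERIV_imp_deriv)
qed

lemma Delta_speed:
  assumes mem: "(v, \<theta>, w) \<in> \<Delta>" and c: "0 < cos \<theta>"
  shows "w\<^sup>2 = cos \<theta> ^ 3 * (2 - v\<^sup>2 / Wf \<theta>)"
proof -
  define C y where "C = cos \<theta>" and "y = Wf \<theta>"
  have C: "0 < C" and y: "0 < y" using c W_pos[OF c] by (auto simp: C_def y_def)
  have U: "Uf \<theta> = y * C ^ 3" using U_eq_W_cos3[of \<theta>] c by (simp add: C_def y_def)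
  have "w\<^sup>2 + C ^ 6 / (y * C ^ 3) * v\<^sup>2 = 2 * C ^ 3"
    using mem unfolding Delta_iff U C_def[symmetric] by blast
  moreover have "C ^ 6 / (y * C ^ 3) = C ^ 3 / y"
  proof -
    have "C ^ 6 = C ^ 3 * C ^ 3" by (simp flip: power_add)
    then show ?thesis using C y by (simp only: times_divide_times_eq[symmetric] mult.commute[of y]) simp
  qed
  ultimately have "w\<^sup>2 + C ^ 3 / y * v\<^sup>2 = 2 * C ^ 3" by (simp only:)
  then show ?thesis by (simp add: right_diff_distrib C_def y_def)
qed

lemma Delta_velocity_le:
  assumes mem: "(v, \<theta>, w) \<in> \<Delta>" and c: "0 < cos \<theta>"
  shows "v\<^sup>2 \<le> 2 * Wf \<theta>"
proof -
  have "0 \<le> cos \<theta> ^ 3 * (2 - v\<^sup>2 / Wf \<theta>)" using Delta_speed[OF assms] by (metis zero_le_power2)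
  then have "v\<^sup>2 / Wf \<theta> \<le> 2" using c by (simp add: zero_le_mult_iff)
  then show ?thesis using W_pos[OF c] by (simp add: pos_divide_le_eq)
qed

lemma turning_point_velocity:
  assumes mem: "(v, \<theta>, 0) \<in> \<Delta>" and c: "0 < cos \<theta>"
  shows "v\<^sup>2 = 2 * Wf \<theta>"
proof -
  have "v\<^sup>2 / Wf \<theta> = 2" using Delta_speed[OF assms] c by simp
  then show ?thesis using W_pos[OF c] by (simp add: nonzero_divide_eq_eq)
qed

text \<open>
  Where \<open>w = 0\<close>, the energy relation gives \<open>v\<^sup>2 = 2 W\<close>. Inserting \<open>U = W cos\<^sup>3 \<theta>\<close>, all terms
  that do not contain \<open>W'\<close> cancel.
\<close>

lemma turning_point_acceleration:
  assumes mem: "(v, \<theta>, 0) \<in> \<Delta>" and c: "0 < cos \<theta>" and W': "(Wf has_real_derivative d) (at \<theta>)"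
  shows "angvel_rate v \<theta> 0 = d * cos \<theta> ^ 3 / Wf \<theta>"
proof -
  define C s y where "C = cos \<theta>" and "s = sin \<theta>" and "y = Wf \<theta>"
  have C: "0 < C" and y: "0 < y" using c W_pos[OF c] by (auto simp: C_def y_def)
  have U: "Uf \<theta> = y * C ^ 3" using U_eq_W_cos3[of \<theta>] c by (simp add: C_def y_def)
  have v: "v\<^sup>2 = 2 * y" using turning_point_velocity[OF mem c] by (simp add: y_def)
  have "angvel_rate v \<theta> 0 = (d * C ^ 3 - 3 * C\<^sup>2 * s * y) / (y * C ^ 3) * C ^ 3 - 3 * s * C\<^sup>2
      + 3 * s * C ^ 5 / (y * C ^ 3) * (2 * y)"
    unfolding angvel_rate_def deriv_U_from_W[OF c W'] U v by (simp add: C_def s_def y_def)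
  also have "\<dots> = d * C ^ 3 / y"
    using C y by (simp add: divide_simps) (simp add: algebra_simps power2_eq_square power3_eq_cube eval_nat_numeral)
  finally show ?thesis by (simp add: C_def y_def)
qed

section \<open>The barrier argument\<close>

abbreviation vel :: "(real \<Rightarrow> real \<times> real \<times> real) \<Rightarrow> real \<Rightarrow> real" where "vel x t \<equiv> fst (x t)"
abbreviation ang :: "(real \<Rightarrow> real \<times> real \<times> real) \<Rightarrow> real \<Rightarrow> real" where "ang x t \<equiv> fst (snd (x t))"
abbreviation angvel :: "(real \<Rightarrow> real \<times> real \<times> real) \<Rightarrow> real \<Rightarrow> real" where "angvel x t \<equiv> snd (snd (x t))"

text \<open>
  The state space for the barrier argument. The condition for \<open>\<theta> \<le> \<theta>\<^sub>w\<close> bounds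
  \<open>v + k \<theta>\<close> from below, a quantity that is nondecreasing up to \<open>\<theta>\<^sub>w\<close>; the constant is chosen so that the bound
  at \<open>\<theta> = \<theta>\<^sub>w\<close> becomes \<open>v > - \<surd>(2 W(\<theta>\<^sub>w))\<close>. All conditions are strict, and those on
  quantities monotone along orbits with \<open>w \<ge> 0\<close> survive limits; only \<open>\<theta> < \<pi>/2\<close> has to be checked
  separately.
\<close>

definition region :: "(real \<times> real \<times> real) set" where
  "region = {(v, \<theta>, w). - tw < \<theta> \<and> \<theta> < pi / 2 \<and> v < Vm \<and> (\<theta> \<le> tw \<longrightarrow> k * tw - Vm < v + k * \<theta>)}"

text \<open>
  At the end points only continuity is required, so that the notion applies to a solution whose
  third component is not yet known to be differentiable when it first vanishes.
\<close>

definition trajectory :: "real \<Rightarrow> real \<Rightarrow> (real \<Rightarrow> real \<times> real \<times> real) \<Rightarrow> bool" where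
  "trajectory a b x \<longleftrightarrow> continuous_on {a..b} x \<and> (\<forall>t\<in>{a..b}. x t \<in> \<Delta>) \<and>
     (\<forall>t\<in>{a<..<b}. (x has_vector_derivative X (x t)) (at t))"

lemma trajectory_subinterval:
  "trajectory a b x \<Longrightarrow> a \<le> a' \<Longrightarrow> b' \<le> b \<Longrightarrow> trajectory a' b' x"
  unfolding trajectory_def by (auto intro: continuous_on_subset)

lemma solution_in_trajectory:
  assumes "solution_in X \<Delta> I x" "{a..b} \<subseteq> I"
  shows "trajectory a b x"
  unfolding trajectory_def
proof (intro conjI ballI)
  have der: "(x has_vector_derivative X (x t)) (at t within {a..b})" if "t \<in> {a..b}" for t
    using assms that unfolding solution_in_def by (meson has_vector_derivative_within_subset subsetD)
  show "continuous_on {a..b} x"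
    by (rule continuous_on_vector_derivative[OF der])
  fix t
  show "t \<in> {a..b} \<Longrightarrow> x t \<in> \<Delta>" using assms unfolding solution_in_def by blast
  assume t: "t \<in> {a<..<b}"
  then have "t \<in> interior {a..b}" by simp
  then show "(x has_vector_derivative X (x t)) (at t)"
    using der[of t] t by (metis at_within_interior interior_subset subsetD)
qed

lemma component_derivatives:
  assumes "(x has_vector_derivative X (x t)) F"
  shows "(vel x has_real_derivative vel_rate (vel x t) (ang x t)) F"
    and "(ang x has_real_derivative angvel x t) F"
    and "(angvel x has_real_derivative angvel_rate (vel x t) (ang x t) (angvel x t)) F"
proof -
  have eq: "X (x t) = (vel_rate (vel x t) (ang x t), angvel x t, angvel_rate (vel x t) (ang x t) (angvel x t))"
    using X_eq[of "vel x t" "ang x t" "angvel x t"] by simp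
  note d = assms[unfolded eq]
  note d1 = bounded_linear.has_vector_derivative[OF bounded_linear_fst d]
    and d2 = bounded_linear.has_vector_derivative[OF bounded_linear_snd d]
  note d21 = bounded_linear.has_vector_derivative[OF bounded_linear_fst d2]
    and d22 = bounded_linear.has_vector_derivative[OF bounded_linear_snd d2]
  show "(vel x has_real_derivative vel_rate (vel x t) (ang x t)) F"
    "(ang x has_real_derivative angvel x t) F"
    "(angvel x has_real_derivative angvel_rate (vel x t) (ang x t) (angvel x t)) F"
    using d1 d21 d22 by (simp_all add: has_real_derivative_iff_has_vector_derivative)
qed

lemma component_continuity:
  assumes "continuous_on S x"
  shows "continuous_on S (vel x)" "continuous_on S (ang x)" "continuous_on S (angvel x)"
  using assms by (auto intro: continuous_intros)

lemma tendsto_angvel_rate: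
  fixes v \<theta> w :: "real \<Rightarrow> real"
  assumes "(v \<longlongrightarrow> v0) F" "(\<theta> \<longlongrightarrow> \<theta>0) F" "(w \<longlongrightarrow> w0) F" and c: "0 \<le> cos \<theta>0"
  shows "((\<lambda>t. angvel_rate (v t) (\<theta> t) (w t)) \<longlongrightarrow> angvel_rate v0 \<theta>0 w0) F"
proof -
  have U: "((\<lambda>t. Uf (\<theta> t)) \<longlongrightarrow> Uf \<theta>0) F" by (rule isCont_tendsto_compose[OF isCont_U assms(2)])
  have U': "((\<lambda>t. deriv Uf (\<theta> t)) \<longlongrightarrow> deriv Uf \<theta>0) F"
    by (rule isCont_tendsto_compose[OF isCont_deriv_U assms(2)])
  have "Uf \<theta>0 \<noteq> 0" "2 * sqrt (Uf \<theta>0) \<noteq> 0" using U_pos[OF c] by auto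
  then show ?thesis unfolding angvel_rate_def
    by (intro tendsto_intros assms U U' tendsto_cos[OF assms(2)] tendsto_sin[OF assms(2)]) simp_all
qed

text \<open>
  A turning point in the region has \<open>v \<le> - \<surd>(2 W(\<theta>\<^sub>w))\<close>, because \<open>\<theta>\<^sub>w\<close> minimises \<open>W\<close>. The
  lower bound on \<open>v + k \<theta>\<close> forbids this up to \<open>\<theta>\<^sub>w\<close>, and beyond \<open>\<theta>\<^sub>w\<close> the potential pushes \<open>w\<close> up.
\<close>

lemma region_turning_point:
  assumes mem: "(v, \<theta>, 0) \<in> \<Delta>" and reg: "(v, \<theta>, 0) \<in> region"
  shows "0 < angvel_rate v \<theta> 0"
proof -
  have th: "- tw < \<theta>" "\<theta> < pi / 2" and v: "v < Vm"
    and low: "\<theta> \<le> tw \<Longrightarrow> k * tw - Vm < v + k * \<theta>" using reg by (auto simp: region_def)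
  have th': "\<bar>\<theta>\<bar> < pi / 2" using th cos_theta_w by linarith
  have c: "0 < cos \<theta>" using th' by (intro cos_gt_zero_pi) linarith+
  have W0: "0 < Wf 0" by (rule W_pos) simp
  have "Vm \<le> sqrt (2 * Wf \<theta>)" using W_ge_Wtw[OF th'] by simp
  also have "\<dots> = \<bar>v\<bar>" using turning_point_velocity[OF mem c] by (metis real_sqrt_abs)
  finally have "v \<le> - Vm" using v by linarith
  have "tw < \<theta>"
  proof (rule ccontr)
    assume "\<not> tw < \<theta>"
    then have "\<theta> \<le> tw" by simp
    then have "k * \<theta> \<le> k * tw" using W0 by (intro mult_left_mono) auto
    with low[OF \<open>\<theta> \<le> tw\<close>] \<open>v \<le> - Vm\<close> show False by linarith
  qed
  then obtain d where "0 < d" and d: "(Wf has_real_derivative d) (at \<theta>)"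
    using W_increasing_beyond th by blast
  then show ?thesis
    unfolding turning_point_acceleration[OF mem c d] using c W_pos[OF c] by simp
qed

text \<open>
  For the last claim: \<open>w\<^sup>2 \<le> 2 cos\<^sup>3 \<theta>\<close> gives \<open>w \<le> 2 (\<pi>/2 - \<theta>)\<close>, so that
  \<open>(\<pi>/2 - \<theta>) exp (2 t)\<close> is nondecreasing and \<open>\<theta>\<close> cannot reach \<open>\<pi>/2\<close> in finite time.
\<close>

lemma trajectory_monotone:
  assumes tr: "trajectory a b x" and ab: "a \<le> b" and w: "\<And>t. t \<in> {a..b} \<Longrightarrow> 0 \<le> angvel x t"
  shows "vel x b \<le> vel x a" and "ang x a \<le> ang x b"
    and "- tw \<le> ang x a \<Longrightarrow> ang x b \<le> tw \<Longrightarrow> vel x a + k * ang x a \<le> vel x b + k * ang x b"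
    and "ang x a < pi / 2 \<Longrightarrow> ang x b < pi / 2"
proof -
  have cont: "continuous_on {a..b} x" and mem: "\<And>t. t \<in> {a..b} \<Longrightarrow> x t \<in> \<Delta>"
    and der: "\<And>t. t \<in> {a<..<b} \<Longrightarrow> (x has_vector_derivative X (x t)) (at t)"
    using tr unfolding trajectory_def by auto
  note conts = component_continuity[OF cont]
  note ders = component_derivatives[OF der]
  have mem': "(vel x t, ang x t, angvel x t) \<in> \<Delta>" if "t \<in> {a..b}" for t using mem[OF that] by simp
  show "vel x b \<le> vel x a"
  proof (rule DERIV_nonpos_imp_decreasing_open[OF ab _ conts(1)])
    fix t assume "a < t" "t < b"
    then show "\<exists>y. (vel x has_real_derivative y) (at t) \<and> y \<le> 0"
      using ders(1)[of t] vel_rate_nonpos[OF mem'[of t]] by (intro exI conjI) auto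
  qed
  show mono: "ang x a \<le> ang x b"
  proof (rule DERIV_nonneg_imp_increasing_open[OF ab _ conts(2)])
    fix t assume "a < t" "t < b"
    then show "\<exists>y. (ang x has_real_derivative y) (at t) \<and> 0 \<le> y"
      using ders(2)[of t] w[of t] by (intro exI conjI) auto
  qed
  have ang_mono: "ang x s \<le> ang x t" if "a \<le> s" "s \<le> t" "t \<le> b" for s t
  proof (rule DERIV_nonneg_imp_increasing_open[OF that(2)])
    show "continuous_on {s..t} (ang x)" using conts(2) that by (auto intro: continuous_on_subset)
    fix r assume "s < r" "r < t"
    then show "\<exists>y. (ang x has_real_derivative y) (at r) \<and> 0 \<le> y"
      using ders(2)[of r] w[of r] that by (intro exI conjI) auto
  qed
  show "vel x a + k * ang x a \<le> vel x b + k * ang x b" if "- tw \<le> ang x a" "ang x b \<le> tw"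
  proof (rule DERIV_nonneg_imp_increasing_open[OF ab, where f = "\<lambda>t. vel x t + k * ang x t"])
    show "continuous_on {a..b} (\<lambda>t. vel x t + k * ang x t)" by (intro continuous_intros conts)
    fix t assume t: "a < t" "t < b"
    then have tt: "t \<in> {a<..<b}" "t \<in> {a..b}" by auto
    have "\<bar>ang x t\<bar> \<le> tw" using ang_mono[of a t] ang_mono[of t b] t that by linarith
    from drift(1)[OF mem'[OF tt(2)] this w[OF tt(2)]]
    show "\<exists>y. ((\<lambda>t. vel x t + k * ang x t) has_real_derivative y) (at t) \<and> 0 \<le> y"
      using DERIV_add[OF ders(1)[OF tt(1)] DERIV_cmult[OF ders(2)[OF tt(1)], of k]] by blast
  qed
  assume lt: "ang x a < pi / 2"
  \<comment> \<open>Any rate of at least \<open>\<surd>2\<close> would do.\<close>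
  define g where "g t = (pi / 2 - ang x t) * exp (2 * t)" for t
  have "g a \<le> g b"
  proof (rule DERIV_nonneg_imp_increasing_open[OF ab])
    show "continuous_on {a..b} g" unfolding g_def by (intro continuous_intros conts)
    fix t assume t: "a < t" "t < b"
    then have tt: "t \<in> {a<..<b}" "t \<in> {a..b}" by auto
    let ?y = "pi / 2 - ang x t"
    have th: "- (pi / 2) \<le> ang x t" "ang x t \<le> pi / 2"
      using mem'[OF tt(2)] unfolding Delta_iff by blast+
    have y: "0 \<le> ?y" using th by simp
    have c: "0 \<le> cos (ang x t)" by (rule Delta_cos_nonneg[OF mem'[OF tt(2)]])
    have cy: "cos (ang x t) \<le> ?y" using sin_x_le_x[OF y] by (simp add: sin_diff)
    have "(angvel x t)\<^sup>2 \<le> 2 * cos (ang x t) ^ 3" by (rule Delta_w_le[OF mem'[OF tt(2)]])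
    also have "cos (ang x t) ^ 3 \<le> cos (ang x t) ^ 2" using c by (intro power_decreasing) auto
    also have "cos (ang x t) ^ 2 \<le> ?y ^ 2" using c cy by (intro power_mono)
    finally have "(angvel x t)\<^sup>2 \<le> 2 * ?y\<^sup>2" by simp
    also have "\<dots> \<le> (2 * ?y)\<^sup>2" unfolding power_mult_distrib by simp
    finally have wy: "angvel x t \<le> 2 * ?y"
      by (rule power2_le_imp_le[OF _ mult_nonneg_nonneg[OF _ y]]) simp
    have "(g has_real_derivative (0 - angvel x t) * exp (2 * t) + (exp (2 * t) * (2 * 1)) * ?y) (at t)"
      unfolding g_def
      by (intro DERIV_mult DERIV_diff DERIV_const ders(2)[OF tt(1)] DERIV_fun_exp DERIV_cmult DERIV_ident)
    moreover have "(0 - angvel x t) * exp (2 * t) + (exp (2 * t) * (2 * 1)) * ?y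
        = exp (2 * t) * (2 * ?y - angvel x t)" by (simp add: algebra_simps)
    ultimately show "\<exists>y. (g has_real_derivative y) (at t) \<and> 0 \<le> y" using wy
      by (metis exp_ge_zero mult_nonneg_nonneg diff_ge_0_iff_ge)
  qed
  moreover have "0 < g a" using lt by (simp add: g_def)
  ultimately have "0 < g b" by linarith
  then show "ang x b < pi / 2" by (simp add: g_def zero_less_mult_iff)
qed

lemma region_preserved:
  assumes tr: "trajectory a b x" and ab: "a \<le> b" and w: "\<And>t. t \<in> {a..b} \<Longrightarrow> 0 \<le> angvel x t"
    and start: "x a \<in> region"
  shows "x b \<in> region"
proof -
  note mono = trajectory_monotone[OF tr ab w]
  have s: "- tw < ang x a" "ang x a < pi / 2" "vel x a < Vm"
    "ang x a \<le> tw \<Longrightarrow> k * tw - Vm < vel x a + k * ang x a"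
    using start by (auto simp: region_def split: prod.splits)
  have "ang x b \<le> tw \<longrightarrow> k * tw - Vm < vel x b + k * ang x b"
    using s mono(2,3) by fastforce
  moreover have "- tw < ang x b" "ang x b < pi / 2" "vel x b < Vm" using s mono by linarith+
  ultimately have "(vel x b, ang x b, angvel x b) \<in> region" unfolding region_def by blast
  then show ?thesis by simp
qed

text \<open>
  At a first zero of \<open>w\<close> the orbit would still be in the region, so \<open>w'\<close> would be positive
  shortly before that time, and \<open>w\<close> would increase to \<open>0\<close> from a positive value.
\<close>

lemma angvel_stays_positive:
  assumes tr: "trajectory a b x" and t: "t \<in> {a..b}"
    and start: "x a \<in> region" "0 < angvel x a"
  shows "0 < angvel x t \<and> x t \<in> region"
proof -
  have cont: "continuous_on {a..b} x" and mem: "\<And>t. t \<in> {a..b} \<Longrightarrow> x t \<in> \<Delta>"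
    and der: "\<And>t. t \<in> {a<..<b} \<Longrightarrow> (x has_vector_derivative X (x t)) (at t)"
    using tr unfolding trajectory_def by auto
  note conts = component_continuity[OF cont]
  have pos: "0 < angvel x s" if s: "s \<in> {a..b}" for s
  proof (rule ccontr)
    assume "\<not> 0 < angvel x s"
    have "continuous_on {a..s} (angvel x)" using conts(3) s by (auto intro: continuous_on_subset)
    then obtain T where aT: "a < T" and "T \<le> s" and zero: "angvel x T = 0"
      and before: "\<And>r. a \<le> r \<Longrightarrow> r < T \<Longrightarrow> 0 < angvel x r"
      using first_zero[of a s "angvel x"] start(2) s \<open>\<not> 0 < angvel x s\<close> by (auto simp: not_less)
    with s have Tb: "T \<le> b" by simp
    have trT: "trajectory a T x" by (rule trajectory_subinterval[OF tr]) (use Tb in auto)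
    have "0 \<le> angvel x r" if "r \<in> {a..T}" for r
      using that before[of r] zero by (cases "r = T") auto
    from region_preserved[OF trT _ this start(1)] aT have regT: "x T \<in> region" by simp
    have memT: "x T \<in> \<Delta>" using mem aT Tb by simp
    have xT: "x T = (vel x T, ang x T, 0)" using zero by (simp add: prod_eq_iff)
    have up: "0 < angvel_rate (vel x T) (ang x T) (angvel x T)"
      unfolding zero using region_turning_point[of "vel x T" "ang x T"] regT memT xT by metis
    have c: "0 \<le> cos (ang x T)" using Delta_cos_nonneg memT xT by metis
    have "(x \<longlongrightarrow> x T) (at_left T)"
    proof -
      have "continuous_on {a..T} x" using cont Tb by (auto intro: continuous_on_subset)
      then have "(x \<longlongrightarrow> x T) (at T within {a..T})" using aT by (simp add: continuous_on)
      then show ?thesis using at_within_Icc_at_left[OF aT] by simp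
    qed
    then have "((\<lambda>r. angvel_rate (vel x r) (ang x r) (angvel x r)) \<longlongrightarrow> angvel_rate (vel x T) (ang x T) (angvel x T)) (at_left T)"
      by (intro tendsto_angvel_rate c tendsto_intros)
    from order_tendstoD(1)[OF this up]
    obtain r0 where r0: "r0 < T" "\<And>r. r0 < r \<Longrightarrow> r < T \<Longrightarrow> 0 < angvel_rate (vel x r) (ang x r) (angvel x r)"
      unfolding eventually_at_left_field by blast
    let ?r = "max a r0"
    have "angvel x ?r < angvel x T"
    proof (rule DERIV_pos_imp_increasing_open[where f = "angvel x"])
      show "?r < T" using aT r0 by simp
      show "continuous_on {?r..T} (angvel x)" using conts(3) Tb by (auto intro: continuous_on_subset)
      fix r assume r: "?r < r" "r < T"
      then have "r \<in> {a<..<b}" using Tb by auto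
      then show "\<exists>y. (angvel x has_real_derivative y) (at r) \<and> 0 < y"
        using component_derivatives(3)[OF der] r0(2)[of r] r by auto
    qed
    then show False using before[of ?r] aT r0 zero by simp
  qed
  have "trajectory a t x" by (rule trajectory_subinterval[OF tr]) (use t in auto)
  then have "x t \<in> region"
    by (rule region_preserved) (use t pos start in \<open>auto intro!: less_imp_le\<close>)
  with pos t show ?thesis by blast
qed

section \<open>Limits of forward orbits, and the start of the branch\<close>

lemma Delta_limit:
  assumes "((\<lambda>t. (v t, \<theta> t, w t)) \<longlongrightarrow> (v0, \<theta>0, w0)) (F :: real filter)" "F \<noteq> bot"
    and "\<forall>\<^sub>F t in F. (v t, \<theta> t, w t) \<in> \<Delta>" and c: "0 \<le> cos \<theta>0"
  shows "(v0, \<theta>0, w0) \<in> \<Delta>"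
proof -
  have lim: "(v \<longlongrightarrow> v0) F" "(\<theta> \<longlongrightarrow> \<theta>0) F" "(w \<longlongrightarrow> w0) F"
    using tendsto_fst[OF assms(1)] tendsto_snd[OF assms(1)] tendsto_fst tendsto_snd by fastforce+
  have U: "((\<lambda>t. Uf (\<theta> t)) \<longlongrightarrow> Uf \<theta>0) F" by (rule isCont_tendsto_compose[OF isCont_U lim(2)])
  have "Uf \<theta>0 \<noteq> 0" using U_pos[OF c] by simp
  then have "((\<lambda>t. (w t)\<^sup>2 + cos (\<theta> t) ^ 6 / Uf (\<theta> t) * (v t)\<^sup>2) \<longlongrightarrow> w0\<^sup>2 + cos \<theta>0 ^ 6 / Uf \<theta>0 * v0\<^sup>2) F"
    by (intro tendsto_intros lim U tendsto_cos[OF lim(2)])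
  moreover have "((\<lambda>t. (w t)\<^sup>2 + cos (\<theta> t) ^ 6 / Uf (\<theta> t) * (v t)\<^sup>2) \<longlongrightarrow> 2 * cos \<theta>0 ^ 3) F"
  proof (rule Lim_transform_eventually)
    show "((\<lambda>t. 2 * cos (\<theta> t) ^ 3) \<longlongrightarrow> 2 * cos \<theta>0 ^ 3) F"
      by (intro tendsto_intros tendsto_cos[OF lim(2)])
    show "\<forall>\<^sub>F t in F. 2 * cos (\<theta> t) ^ 3 = (w t)\<^sup>2 + cos (\<theta> t) ^ 6 / Uf (\<theta> t) * (v t)\<^sup>2"
      using assms(3) by eventually_elim (simp add: Delta_iff)
  qed
  ultimately have "w0\<^sup>2 + cos \<theta>0 ^ 6 / Uf \<theta>0 * v0\<^sup>2 = 2 * cos \<theta>0 ^ 3"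
    using tendsto_unique[OF assms(2)] by blast
  moreover have "- (pi / 2) \<le> \<theta>0"
    by (rule tendsto_lowerbound[OF lim(2) _ assms(2)])
      (use assms(3) in \<open>eventually_elim, unfold Delta_iff, blast\<close>)
  moreover have "\<theta>0 \<le> pi / 2"
    by (rule tendsto_upperbound[OF lim(2) _ assms(2)])
      (use assms(3) in \<open>eventually_elim, unfold Delta_iff, blast\<close>)
  ultimately show ?thesis unfolding Delta_iff by blast
qed

text \<open>
  If \<open>\<theta>\<close> had a limit \<open>L < \<pi>/2\<close>, then \<open>v\<close> would be bounded by \<open>v\<^sup>2 \<le> 2 W(\<theta>)\<close>, hence convergent,
  and \<open>w\<close> would converge too, necessarily to \<open>0\<close>. The limit is a turning point that still lies in
  the region, so \<open>w\<close> is eventually increasing, which contradicts \<open>w \<rightarrow> 0\<close>.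
\<close>

lemma forward_limits:
  assumes sol: "solution_in X \<Delta> {0..} x" and start: "x 0 \<in> region" "0 < angvel x 0"
  shows "(ang x \<longlongrightarrow> pi / 2) at_top" "(angvel x \<longlongrightarrow> 0) at_top"
proof -
  have traj: "trajectory s t x" if "0 \<le> s" for s t
    by (rule solution_in_trajectory[OF sol]) (use that in auto)
  have wpos: "0 < angvel x t" and reg: "x t \<in> region" if "0 \<le> t" for t
    using angvel_stays_positive[OF traj[of 0 t] _ start] that by auto
  have mem: "(vel x t, ang x t, angvel x t) \<in> \<Delta>" if "0 \<le> t" for t
    using sol that unfolding solution_in_def by simp
  have mono: "vel x t \<le> vel x s" "ang x s \<le> ang x t"
    "- tw \<le> ang x s \<Longrightarrow> ang x t \<le> tw \<Longrightarrow> vel x s + k * ang x s \<le> vel x t + k * ang x t"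
    if "0 \<le> s" "s \<le> t" for s t
  proof -
    have "0 \<le> angvel x r" if "r \<in> {s..t}" for r
      using wpos[of r] that \<open>0 \<le> s\<close> by simp
    note mono = trajectory_monotone[OF traj[OF that(1)] that(2) this]
    show "vel x t \<le> vel x s" by (rule mono(1))
    show "ang x s \<le> ang x t" by (rule mono(2))
    show "vel x s + k * ang x s \<le> vel x t + k * ang x t" if "- tw \<le> ang x s" "ang x t \<le> tw"
      using mono(3) that by blast
  qed
  have der: "(x has_vector_derivative X (x t)) (at t)" if "0 < t" for t
    using traj[of 0 "t + 1"] that unfolding trajectory_def by auto
  have s0: "- tw < ang x 0" "vel x 0 < Vm"
    "ang x 0 \<le> tw \<Longrightarrow> k * tw - Vm < vel x 0 + k * ang x 0"
    using start(1) by (auto simp: region_def split: prod.splits)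
  have ang_lt: "ang x t < pi / 2" if "0 \<le> t" for t
    using reg[OF that] by (auto simp: region_def split: prod.splits)
  obtain L where L: "(ang x \<longlongrightarrow> L) at_top" "\<And>t. 0 \<le> t \<Longrightarrow> ang x t \<le> L"
    using eventually_bounded_mono_converges[of "ang x" "pi / 2"] mono(2) ang_lt
    by (metis (no_types, lifting) eventually_at_top_linorder less_imp_le)
  have L_le: "L \<le> pi / 2"
    by (rule tendsto_upperbound[OF L(1)])
      (use ang_lt in \<open>auto simp: eventually_at_top_linorder intro!: exI[of _ 0] less_imp_le\<close>)
  have L_gt: "- tw < L" using L(2)[of 0] s0(1) by simp
  have L_eq: "L = pi / 2"
  proof (rule ccontr)
    assume "L \<noteq> pi / 2"
    then have Lb: "- (pi / 2) < L" "L < pi / 2" using L_le L_gt cos_theta_w by linarith+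
    then have c: "0 < cos L" by (intro cos_gt_zero_pi) linarith+
    have c0: "0 \<le> cos L" using c by simp
    have U: "((\<lambda>t. Uf (ang x t)) \<longlongrightarrow> Uf L) at_top" by (rule isCont_tendsto_compose[OF isCont_U L(1)])
    have Upos: "0 < Uf L" by (rule U_pos[OF c0])
    have cosl: "((\<lambda>t. cos (ang x t)) \<longlongrightarrow> cos L) at_top" by (rule tendsto_cos[OF L(1)])
    define K where "K = 2 * Wf L + 1"
    have "isCont Wf L" using W_deriv[OF c] by (rule DERIV_isCont)
    then have "((\<lambda>t. 2 * Wf (ang x t)) \<longlongrightarrow> 2 * Wf L) at_top"
      by (intro tendsto_intros isCont_tendsto_compose[OF _ L(1)])
    then have "\<forall>\<^sub>F t in at_top. 2 * Wf (ang x t) < K"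
      by (rule order_tendstoD(2)) (simp add: K_def)
    then have "\<forall>\<^sub>F t in at_top. - vel x t \<le> sqrt K"
      using eventually_ge_at_top[of 0]
    proof eventually_elim
      case (elim t)
      then have "(vel x t)\<^sup>2 \<le> 2 * Wf (ang x t)"
        using Delta_velocity_le[OF mem Delta_cos_pos[OF mem]] wpos[of t] by simp
      with elim have "(- vel x t)\<^sup>2 \<le> K" by simp
      then show ?case by (rule real_le_rsqrt)
    qed
    moreover have "- vel x s \<le> - vel x t" if "0 \<le> s" "s \<le> t" for s t using mono(1)[OF that] by simp
    ultimately obtain L' where L': "((\<lambda>t. - vel x t) \<longlongrightarrow> L') at_top" "\<And>t. 0 \<le> t \<Longrightarrow> - vel x t \<le> L'"
      using eventually_bounded_mono_converges[of "\<lambda>t. - vel x t" "sqrt K"] by blast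
    define Lv where "Lv = - L'"
    have Lv: "(vel x \<longlongrightarrow> Lv) at_top" using tendsto_minus[OF L'(1)] by (simp add: Lv_def)
    define Lw where "Lw = sqrt (2 * cos L ^ 3 - cos L ^ 6 / Uf L * Lv\<^sup>2)"
    have Lw: "(angvel x \<longlongrightarrow> Lw) at_top"
    proof (rule Lim_transform_eventually)
      show "((\<lambda>t. sqrt (2 * cos (ang x t) ^ 3 - cos (ang x t) ^ 6 / Uf (ang x t) * (vel x t)\<^sup>2)) \<longlongrightarrow> Lw) at_top"
        unfolding Lw_def using Upos by (intro tendsto_intros U cosl Lv) simp
      show "\<forall>\<^sub>F t in at_top. sqrt (2 * cos (ang x t) ^ 3 - cos (ang x t) ^ 6 / Uf (ang x t) * (vel x t)\<^sup>2) = angvel x t"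
        using eventually_ge_at_top[of 0]
      proof eventually_elim
        case (elim t)
        have "2 * cos (ang x t) ^ 3 - cos (ang x t) ^ 6 / Uf (ang x t) * (vel x t)\<^sup>2 = (angvel x t)\<^sup>2"
          using mem[OF elim] unfolding Delta_iff by linarith
        then show ?case using wpos[OF elim] by simp
      qed
    qed
    have evpos: "\<forall>\<^sub>F t in at_top. 0 < (t::real)" by (rule eventually_gt_at_top)
    \<comment> \<open>\<open>Lw\<close> is the limit of \<open>\<theta>'\<close>, and \<open>\<theta>\<close> converges.\<close>
    have "Lw \<le> 0"
      by (rule convergent_derivative_limit_nonpos[OF L(1) Lw])
        (use evpos in \<open>eventually_elim, use component_derivatives(2)[OF der] in blast\<close>)
    moreover have "0 \<le> Lw"
      by (rule tendsto_lowerbound[OF Lw])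
        (use wpos in \<open>auto simp: eventually_at_top_linorder intro!: exI[of _ 0] less_imp_le\<close>)
    ultimately have Lw0: "Lw = 0" by simp
    \<comment> \<open>The limit state is a turning point in the region.\<close>
    have memL: "(Lv, L, 0) \<in> \<Delta>"
    proof (rule Delta_limit[OF _ _ _ c0])
      show "((\<lambda>t. (vel x t, ang x t, angvel x t)) \<longlongrightarrow> (Lv, L, 0)) at_top"
        using Lw Lw0 by (intro tendsto_Pair Lv L(1)) simp
      show "\<forall>\<^sub>F t in at_top. (vel x t, ang x t, angvel x t) \<in> \<Delta>"
        using eventually_ge_at_top[of 0] by eventually_elim (rule mem)
    qed simp
    have "Lv \<le> vel x 0" using L'(2)[of 0] by (simp add: Lv_def)
    moreover have "k * tw - Vm < Lv + k * L" if "L \<le> tw"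
    proof -
      have le: "ang x t \<le> tw" if "0 \<le> t" for t using L(2)[OF that] \<open>L \<le> tw\<close> by simp
      have "((\<lambda>t. vel x t + k * ang x t) \<longlongrightarrow> Lv + k * L) at_top" by (intro tendsto_intros Lv L(1))
      then have "vel x 0 + k * ang x 0 \<le> Lv + k * L"
        by (rule tendsto_lowerbound)
          (use mono(3)[of 0] s0(1) le in \<open>auto simp: eventually_at_top_linorder intro!: exI[of _ 0]\<close>)
      then show ?thesis using s0(3) le[of 0] by linarith
    qed
    ultimately have "(Lv, L, 0) \<in> region" unfolding region_def using s0 L_gt Lb by auto
    from region_turning_point[OF memL this] have up: "0 < angvel_rate Lv L 0" .
    have "((\<lambda>t. angvel_rate (vel x t) (ang x t) (angvel x t)) \<longlongrightarrow> angvel_rate Lv L 0) at_top"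
      using Lw Lw0 by (intro tendsto_angvel_rate Lv L(1) c0) simp
    from order_tendstoD(1)[OF this up]
    obtain N where N: "\<And>t. N \<le> t \<Longrightarrow> 0 < angvel_rate (vel x t) (ang x t) (angvel x t)"
      unfolding eventually_at_top_linorder by blast
    define n where "n = max N 1"
    have "angvel x n \<le> angvel x t" if "n \<le> t" for t
    proof (rule DERIV_nonneg_imp_nondecreasing[OF that])
      fix r assume "n \<le> r"
      then have "0 < r" "N \<le> r" by (auto simp: n_def)
      then show "\<exists>y. (angvel x has_real_derivative y) (at r) \<and> 0 \<le> y"
        using component_derivatives(3)[OF der] N less_imp_le by blast
    qed
    then have "angvel x n \<le> Lw"
      by (intro tendsto_lowerbound[OF Lw]) (auto simp: eventually_at_top_linorder)
    moreover have "0 < angvel x n" by (rule wpos) (simp add: n_def)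
    ultimately show False using Lw0 by linarith
  qed
  show "(ang x \<longlongrightarrow> pi / 2) at_top" using L(1) L_eq by simp
  have "((\<lambda>t. sqrt (2 * cos (ang x t) ^ 3)) \<longlongrightarrow> sqrt (2 * cos (pi / 2) ^ 3)) at_top"
    by (intro tendsto_intros tendsto_cos[OF \<open>(ang x \<longlongrightarrow> pi / 2) at_top\<close>])
  then have upper: "((\<lambda>t. sqrt (2 * cos (ang x t) ^ 3)) \<longlongrightarrow> 0) at_top" by simp
  show "(angvel x \<longlongrightarrow> 0) at_top"
  proof (rule tendsto_sandwich[OF _ _ tendsto_const upper])
    show "\<forall>\<^sub>F t in at_top. 0 \<le> angvel x t"
      using eventually_ge_at_top[of 0] by eventually_elim (use wpos less_imp_le in blast)
    show "\<forall>\<^sub>F t in at_top. angvel x t \<le> sqrt (2 * cos (ang x t) ^ 3)"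
      using eventually_ge_at_top[of 0]
      by eventually_elim (rule real_le_rsqrt[OF Delta_w_le[OF mem]])
  qed
qed

text \<open>
  Far back in time \<open>w > 0\<close>, \<open>v\<close> is near \<open>\<surd>(2 W(\<theta>\<^sub>w))\<close> and \<open>\<theta>\<close> near \<open>- \<theta>\<^sub>w\<close>. Then \<open>\<theta>\<close>, \<open>- v\<close>
  and \<open>v + k \<theta>\<close> are strictly increasing, hence strictly above their limits at \<open>-\<infinity>\<close>. These limits
  satisfy the conditions of the region with \<open>\<le>\<close>, and the gap condition is what this requires of
  \<open>v + k \<theta>\<close>.
\<close>

lemma unstable_branch_in_region:
  assumes gap: "k * tw \<le> Vm"
    and p: "p \<in> unstable_branch X \<Delta> (E_minus M \<mu> B B1) {(v, \<theta>, w). 0 < w}"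
  shows "p \<in> \<Delta>" "p \<in> region" "0 < snd (snd p)"
proof -
  obtain x where sol: "solution_in X \<Delta> {..0} x" and x0: "x 0 = p"
    and lim: "(x \<longlongrightarrow> E_minus M \<mu> B B1) at_bot"
    and ev: "\<forall>\<^sub>F t in at_bot. x t \<in> {(v, \<theta>, w). 0 < w}"
    using p unfolding unstable_branch_def by auto
  have E: "E_minus M \<mu> B B1 = (Vm, - tw, 0)" by (simp add: E_minus_def Let_def)
  have limv: "(vel x \<longlongrightarrow> Vm) at_bot" and lima: "(ang x \<longlongrightarrow> - tw) at_bot"
    using tendsto_fst[OF lim] tendsto_fst[OF tendsto_snd[OF lim]] by (simp_all add: E)
  have "0 < Wf tw" using cos_tw_pos by (rule W_pos)
  then have "\<forall>\<^sub>F t in at_bot. 0 < vel x t" by (intro order_tendstoD(1)[OF limv]) simp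
  moreover have "\<forall>\<^sub>F t in at_bot. ang x t < tw"
    using cos_theta_w by (intro order_tendstoD(2)[OF lima]) simp
  ultimately have "\<forall>\<^sub>F t in at_bot. 0 < angvel x t \<and> 0 < vel x t \<and> ang x t < tw"
    using ev by eventually_elim (auto split: prod.splits)
  then obtain N where N: "\<And>t. t \<le> N \<Longrightarrow> 0 < angvel x t \<and> 0 < vel x t \<and> ang x t < tw"
    unfolding eventually_at_bot_linorder by blast
  \<comment> \<open>A negative time, so that the derivative there is two-sided.\<close>
  define b where "b = min N (-1)"
  have b: "b \<le> N" "b < 0" by (auto simp: b_def)
  have mem: "(vel x t, ang x t, angvel x t) \<in> \<Delta>" if "t \<le> 0" for t
    using sol that unfolding solution_in_def by simp
  have der: "(x has_vector_derivative X (x t)) (at t)" if "t < 0" for t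
    using solution_in_trajectory[OF sol, of "t - 1" 0] that unfolding trajectory_def by auto
  note ders = component_derivatives[OF der]
  have up: "- tw < ang x t" if "t \<le> b" for t
  proof (rule DERIV_pos_imp_increasing_at_bot[OF _ lima])
    fix r assume "r \<le> t"
    then show "\<exists>y. (ang x has_real_derivative y) (at r) \<and> 0 < y"
      using ders(2)[of r] N[of r] b that by auto
  qed
  have down: "- Vm < - vel x b"
  proof (rule DERIV_pos_imp_increasing_at_bot[OF _ tendsto_minus[OF limv]])
    fix r assume r: "r \<le> b"
    then have w: "0 < angvel x r" and r0: "r < 0" "r \<le> 0" using N[of r] b by auto
    have c: "0 < cos (ang x r)" using Delta_cos_pos[OF mem[OF r0(2)]] w by simp
    have "vel_rate (vel x r) (ang x r) < 0"
      unfolding vel_rate_on_Delta[OF mem[OF r0(2)] c] using U_pos[of "ang x r"] c w by simp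
    then show "\<exists>y. ((\<lambda>t. - vel x t) has_real_derivative y) (at r) \<and> 0 < y"
      using DERIV_minus[OF ders(1)[OF r0(1)]] by fastforce
  qed
  have "Vm + k * (- tw) < vel x b + k * ang x b"
  proof (rule DERIV_pos_imp_increasing_at_bot[where f = "\<lambda>t. vel x t + k * ang x t"])
    show "((\<lambda>t. vel x t + k * ang x t) \<longlongrightarrow> Vm + k * (- tw)) at_bot"
      by (intro tendsto_intros limv lima)
    fix r assume r: "r \<le> b"
    then have r0: "r < 0" "r \<le> 0" and n: "0 < angvel x r" "0 < vel x r" "ang x r < tw"
      using N[of r] b by auto
    have "\<bar>ang x r\<bar> \<le> tw" using up[OF r] n by linarith
    from drift(2)[OF mem[OF r0(2)] this]
    have "0 < vel_rate (vel x r) (ang x r) + k * angvel x r" using n by simp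
    then show "\<exists>y. ((\<lambda>t. vel x t + k * ang x t) has_real_derivative y) (at r) \<and> 0 < y"
      using DERIV_add[OF ders(1)[OF r0(1)] DERIV_cmult[OF ders(2)[OF r0(1)], of k]] by blast
  qed
  then have "k * tw - Vm < vel x b + k * ang x b" using gap by linarith
  moreover have "ang x b < pi / 2" using N[OF b(1)] cos_theta_w by linarith
  moreover have "vel x b < Vm" using down by simp
  ultimately have "(vel x b, ang x b, angvel x b) \<in> region"
    unfolding region_def using up[of b] by blast
  then have "x b \<in> region" by simp
  moreover have "trajectory b 0 x" by (rule solution_in_trajectory[OF sol]) auto
  moreover have "0 < angvel x b" using N[OF b(1)] by blast
  ultimately have "0 < angvel x 0 \<and> x 0 \<in> region"
    using angvel_stays_positive[of b 0 x 0] b by simp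
  then show "p \<in> region" "0 < snd (snd p)" using x0 by auto
  show "p \<in> \<Delta>" using mem[of 0] x0 by simp
qed

section \<open>Existence of the forward orbit\<close>

definition speed_sq :: "real \<Rightarrow> real \<Rightarrow> real" where
  "speed_sq v \<theta> = 2 * cos \<theta> ^ 3 - cos \<theta> ^ 6 / Uf \<theta> * v\<^sup>2"

definition clamp_angle :: "real \<Rightarrow> real" where
  "clamp_angle \<theta> = max (- (pi / 2)) (min (pi / 2) \<theta>)"

text \<open>
  The planar system for \<open>(v, \<theta>)\<close> obtained by solving the energy relation for \<open>w \<ge> 0\<close>. Clamping the
  angle keeps \<open>U\<close> positive; with the two cut-offs at \<open>0\<close> the field is bounded, and it agrees
  with the original one on the part of \<open>\<Delta>\<close> with \<open>w \<ge> 0\<close>.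
\<close>

definition planar_field :: "real \<times> real \<Rightarrow> real \<times> real" where
  "planar_field = (\<lambda>(v, \<theta>). (min 0 (vel_rate v (clamp_angle \<theta>)), sqrt (max 0 (speed_sq v (clamp_angle \<theta>)))))"

lemma clamp_bounds: "- (pi / 2) \<le> clamp_angle \<theta>" "clamp_angle \<theta> \<le> pi / 2"
  unfolding clamp_angle_def by (auto simp: max_def min_def)

lemma cos_clamp_nonneg: "0 \<le> cos (clamp_angle \<theta>)"
  by (rule cos_ge_zero) (rule clamp_bounds)+

lemma continuous_clamp:
  assumes "continuous_on S \<theta>"
  shows "continuous_on S (\<lambda>t. clamp_angle (\<theta> t))"
  unfolding clamp_angle_def by (intro continuous_intros assms)

lemma continuous_cos_U_clamp:
  assumes "continuous_on S \<theta>"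
  shows "continuous_on S (\<lambda>t. cos (clamp_angle (\<theta> t)))" "continuous_on S (\<lambda>t. Uf (clamp_angle (\<theta> t)))"
proof -
  note cl = continuous_clamp[OF assms]
  show "continuous_on S (\<lambda>t. cos (clamp_angle (\<theta> t)))" 
    using continuous_on_compose2[OF _ cl, of UNIV cos]
    by (simp add: continuous_at_imp_continuous_on)
  have "continuous_on UNIV Uf" using isCont_U by (simp add: continuous_at_imp_continuous_on)
  from continuous_on_compose2[OF this cl] show "continuous_on S (\<lambda>t. Uf (clamp_angle (\<theta> t)))" by simp
qed

lemma continuous_speed_sq_clamp:
  assumes v: "continuous_on S v" and \<theta>: "continuous_on S \<theta>"
  shows "continuous_on S (\<lambda>t. speed_sq (v t) (clamp_angle (\<theta> t)))"
proof -
  have "Uf (clamp_angle (\<theta> t)) \<noteq> 0" for t using U_pos[OF cos_clamp_nonneg, of "\<theta> t"] by simp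
  then have "continuous_on S (\<lambda>t. cos (clamp_angle (\<theta> t)) ^ 6 / Uf (clamp_angle (\<theta> t)))"
    by (intro continuous_on_divide continuous_on_power continuous_cos_U_clamp[OF \<theta>]) simp
  then show ?thesis unfolding speed_sq_def
    by (intro continuous_on_diff continuous_on_mult continuous_on_power continuous_on_const
        continuous_cos_U_clamp(1)[OF \<theta>] v)
qed

lemma planar_field_continuous: "continuous_on UNIV planar_field"
proof -
  have f: "continuous_on UNIV (fst :: real \<times> real \<Rightarrow> real)" and s: "continuous_on UNIV (snd :: real \<times> real \<Rightarrow> real)"
    by (auto intro: continuous_on_fst continuous_on_snd)
  note cU = continuous_cos_U_clamp[OF s]
  have "Uf (clamp_angle (snd p)) \<noteq> 0" for p :: "real \<times> real"
    using U_pos[OF cos_clamp_nonneg, of "snd p"] by simp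
  then have "continuous_on UNIV (\<lambda>p::real \<times> real. cos (clamp_angle (snd p)) ^ 3 / (2 * sqrt (Uf (clamp_angle (snd p)))))"
    by (intro continuous_on_divide continuous_on_power continuous_on_mult continuous_on_const
        continuous_on_real_sqrt cU) simp
  then have V: "continuous_on UNIV (\<lambda>p::real \<times> real. vel_rate (fst p) (clamp_angle (snd p)))"
    unfolding vel_rate_def
    by (intro continuous_on_diff continuous_on_mult continuous_on_power continuous_on_real_sqrt cU f)
  show ?thesis
    unfolding planar_field_def case_prod_beta
    by (intro continuous_on_Pair continuous_on_min continuous_on_max continuous_on_real_sqrt
        continuous_on_const V continuous_speed_sq_clamp[OF f s])
qed

lemma planar_field_bounded: "\<exists>C. \<forall>p. norm (planar_field p) \<le> C"
proof -
  have "continuous_on {- (pi / 2)..pi / 2} (\<lambda>\<theta>. sqrt (Uf \<theta>))"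
    using isCont_U by (intro continuous_intros continuous_at_imp_continuous_on) auto
  then have "compact ((\<lambda>\<theta>. sqrt (Uf \<theta>)) ` {- (pi / 2)..pi / 2})"
    by (rule compact_continuous_image) simp
  then obtain K where K: "\<And>\<theta>. \<theta> \<in> {- (pi / 2)..pi / 2} \<Longrightarrow> \<bar>sqrt (Uf \<theta>)\<bar> \<le> K"
    unfolding bounded_iff[symmetric] real_norm_def[symmetric]
    using compact_imp_bounded bounded_iff by (metis imageI)
  have "norm (planar_field (v, \<theta>)) \<le> K + sqrt 2" for v \<theta>
  proof -
    let ?\<phi> = "clamp_angle \<theta>"
    have c: "0 \<le> cos ?\<phi>" by (rule cos_clamp_nonneg)
    have u: "0 < sqrt (Uf ?\<phi>)" using U_pos[OF c] by simp
    have "?\<phi> \<in> {- (pi / 2)..pi / 2}" using clamp_bounds by simp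
    then have uK: "sqrt (Uf ?\<phi>) \<le> K" using K by fastforce
    have "0 \<le> cos ?\<phi> ^ 3 / (2 * sqrt (Uf ?\<phi>)) * v\<^sup>2" using c u by simp
    then have "- K \<le> vel_rate v ?\<phi>" using uK unfolding vel_rate_def by linarith
    then have 1: "\<bar>min 0 (vel_rate v ?\<phi>)\<bar> \<le> K" using u uK by linarith
    have "0 \<le> cos ?\<phi> ^ 6 / Uf ?\<phi> * v\<^sup>2" using U_pos[OF c] by simp
    moreover have "cos ?\<phi> ^ 3 \<le> 1" using c by (intro power_le_one) auto
    ultimately have "max 0 (speed_sq v ?\<phi>) \<le> 2" unfolding speed_sq_def by linarith
    then have 2: "\<bar>sqrt (max 0 (speed_sq v ?\<phi>))\<bar> \<le> sqrt 2" by simp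
    show ?thesis unfolding planar_field_def prod.case
      by (rule order_trans[OF norm_Pair_le add_mono]) (use 1 2 in \<open>simp_all only: real_norm_def\<close>)
  qed
  then show ?thesis by (auto simp: split_paired_all)
qed

text \<open>
  The algebra behind the invariance of \<open>\<Delta>\<close>, with \<open>q = \<surd>U\<close>, \<open>a = 1 / q\<close> and \<open>d = U'\<close>: the derivative
  of \<open>2 cos\<^sup>3 \<theta> - cos\<^sup>6 \<theta> v\<^sup>2 / U\<close> along the planar field equals \<open>2 w w'\<close> with the \<open>w'\<close>
  of the original system.
\<close>

lemma speed_derivative_identity:
  fixes a c d q s v w :: real
  assumes qa: "q * a = 1" and w2: "w\<^sup>2 = 2 * c ^ 3 - c ^ 6 * a\<^sup>2 * v\<^sup>2"
  shows "2 * w * (c ^ 3 * a / 2 * v * w + d * a\<^sup>2 * (c ^ 3 - w\<^sup>2 / 2) - 3 * s * c\<^sup>2 + 3 * s * c ^ 5 * a\<^sup>2 * v\<^sup>2)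
    = 2 * (3 * c\<^sup>2 * (- s * w))
      - ((6 * c ^ 5 * (- s * w) * a\<^sup>2 - c ^ 6 * (d * w) * (a\<^sup>2 * a\<^sup>2)) * v\<^sup>2
         + c ^ 6 * a\<^sup>2 * (2 * v * (c ^ 3 * a / 2 * v\<^sup>2 - q)))"
proof -
  have "2 * w * (c ^ 3 * a / 2 * v * w + d * a\<^sup>2 * (c ^ 3 - w\<^sup>2 / 2) - 3 * s * c\<^sup>2 + 3 * s * c ^ 5 * a\<^sup>2 * v\<^sup>2)
    = c ^ 3 * a * v * w\<^sup>2 + d * a\<^sup>2 * w * (2 * c ^ 3 - w\<^sup>2) - 6 * s * c\<^sup>2 * w + 6 * s * c ^ 5 * a\<^sup>2 * v\<^sup>2 * w"
    by (simp add: algebra_simps power2_eq_square)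
  also have "\<dots> = c ^ 3 * a * v * (2 * c ^ 3 - c ^ 6 * a\<^sup>2 * v\<^sup>2) + d * a\<^sup>2 * w * (c ^ 6 * a\<^sup>2 * v\<^sup>2)
      - 6 * s * c\<^sup>2 * w + 6 * s * c ^ 5 * a\<^sup>2 * v\<^sup>2 * w"
    unfolding w2 by simp
  also have "\<dots> = 2 * (3 * c\<^sup>2 * (- s * w))
      - ((6 * c ^ 5 * (- s * w) * a\<^sup>2 - c ^ 6 * (d * w) * (a\<^sup>2 * a\<^sup>2)) * v\<^sup>2
         + (c ^ 9 * a ^ 3 * v ^ 3 - 2 * c ^ 6 * a * v * 1))"
    by (simp add: algebra_simps power2_eq_square eval_nat_numeral)
  also have "c ^ 9 * a ^ 3 * v ^ 3 - 2 * c ^ 6 * a * v * 1 = c ^ 6 * a\<^sup>2 * (2 * v * (c ^ 3 * a / 2 * v\<^sup>2 - q))"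
    unfolding qa[symmetric] by (simp add: algebra_simps power2_eq_square eval_nat_numeral)
  finally show ?thesis .
qed

lemma speed_derivative:
  assumes v: "(v has_real_derivative vel_rate (v t) (\<theta> t)) (at t within I)"
    and \<theta>: "(\<theta> has_real_derivative sqrt (speed_sq (v t) (\<theta> t))) (at t within I)"
    and c: "0 \<le> cos (\<theta> t)" and pos: "0 < speed_sq (v t) (\<theta> t)"
  shows "((\<lambda>t. sqrt (speed_sq (v t) (\<theta> t))) has_real_derivative
      angvel_rate (v t) (\<theta> t) (sqrt (speed_sq (v t) (\<theta> t)))) (at t within I)"
proof -
  have speed_sq_inv: "speed_sq v \<theta> = 2 * cos \<theta> ^ 3 - cos \<theta> ^ 6 * inverse (Uf \<theta>) * v\<^sup>2" for v \<theta>
    by (simp only: speed_sq_def divide_inverse)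
  define w where "w = sqrt (speed_sq (v t) (\<theta> t))"
  define C s q a d where "C = cos (\<theta> t)" and "s = sin (\<theta> t)" and "q = sqrt (Uf (\<theta> t))"
    and "a = inverse q" and "d = deriv Uf (\<theta> t)"
  have u: "0 < Uf (\<theta> t)" by (rule U_pos[OF c])
  have qa: "q * a = 1" using u by (simp add: q_def a_def)
  have ua: "inverse (Uf (\<theta> t)) = a\<^sup>2" using u by (simp add: a_def q_def power_inverse)
  have w0: "0 < w" using pos by (simp add: w_def)
  have w2: "w\<^sup>2 = 2 * C ^ 3 - C ^ 6 * a\<^sup>2 * (v t)\<^sup>2"
    using pos by (simp add: w_def speed_sq_inv ua C_def)
  have "(Uf has_real_derivative d) (at (\<theta> t))"
    unfolding d_def using U_deriv by (metis DERIV_imp_deriv)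
  from DERIV_chain2[OF this \<theta>] have dU: "((\<lambda>t. Uf (\<theta> t)) has_real_derivative d * w) (at t within I)"
    by (simp add: w_def)
  from DERIV_inverse'[OF this] u
  have dUi: "((\<lambda>t. inverse (Uf (\<theta> t))) has_real_derivative - (a\<^sup>2 * (d * w) * a\<^sup>2)) (at t within I)"
    unfolding ua by simp
  have dc: "((\<lambda>t. cos (\<theta> t)) has_real_derivative - s * w) (at t within I)"
    using DERIV_chain2[OF DERIV_cos \<theta>] by (simp add: s_def w_def)
  have dc6: "((\<lambda>t. cos (\<theta> t) ^ 6) has_real_derivative 6 * C ^ 5 * (- s * w)) (at t within I)"
    using DERIV_power[OF dc, of 6] by (simp add: C_def mult_ac)
  have dc3: "((\<lambda>t. cos (\<theta> t) ^ 3) has_real_derivative 3 * C\<^sup>2 * (- s * w)) (at t within I)"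
    using DERIV_power[OF dc, of 3] by (simp add: C_def mult_ac)
  have dv2: "((\<lambda>t. (v t)\<^sup>2) has_real_derivative 2 * v t * vel_rate (v t) (\<theta> t)) (at t within I)"
    using DERIV_power[OF v, of 2] by (simp add: mult_ac)
  have vel_rate_a: "vel_rate (v t) (\<theta> t) = C ^ 3 * a / 2 * (v t)\<^sup>2 - q"
    by (simp add: vel_rate_def C_def q_def a_def inverse_eq_divide)
  have "((\<lambda>t. 2 * cos (\<theta> t) ^ 3 - cos (\<theta> t) ^ 6 * inverse (Uf (\<theta> t)) * (v t)\<^sup>2) has_real_derivative
      2 * (3 * C\<^sup>2 * (- s * w))
      - ((6 * C ^ 5 * (- s * w) * inverse (Uf (\<theta> t)) + - (a\<^sup>2 * (d * w) * a\<^sup>2) * cos (\<theta> t) ^ 6) * (v t)\<^sup>2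
         + (2 * v t * vel_rate (v t) (\<theta> t)) * (cos (\<theta> t) ^ 6 * inverse (Uf (\<theta> t))))) (at t within I)"
    by (rule DERIV_diff[OF DERIV_cmult[OF dc3] DERIV_mult[OF DERIV_mult[OF dc6 dUi] dv2]])
  moreover have "2 * (3 * C\<^sup>2 * (- s * w))
      - ((6 * C ^ 5 * (- s * w) * inverse (Uf (\<theta> t)) + - (a\<^sup>2 * (d * w) * a\<^sup>2) * cos (\<theta> t) ^ 6) * (v t)\<^sup>2
         + (2 * v t * vel_rate (v t) (\<theta> t)) * (cos (\<theta> t) ^ 6 * inverse (Uf (\<theta> t))))
      = 2 * w * angvel_rate (v t) (\<theta> t) w"
  proof -
    have "angvel_rate (v t) (\<theta> t) w = C ^ 3 * a / 2 * v t * w + d * a\<^sup>2 * (C ^ 3 - w\<^sup>2 / 2) - 3 * s * C\<^sup>2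
        + 3 * s * C ^ 5 * a\<^sup>2 * (v t)\<^sup>2"
      unfolding angvel_rate_def divide_inverse[of _ "Uf _"] ua
      by (simp add: C_def s_def d_def q_def a_def inverse_eq_divide)
    then show ?thesis
      unfolding vel_rate_a ua C_def[symmetric]
      using speed_derivative_identity[OF qa w2, of d s] by (simp only: mult_ac) (simp add: algebra_simps)
  qed
  ultimately have "((\<lambda>t. speed_sq (v t) (\<theta> t)) has_real_derivative 2 * w * angvel_rate (v t) (\<theta> t) w) (at t within I)"
    by (simp only: speed_sq_inv)
  from DERIV_chain2[OF DERIV_real_sqrt[OF pos] this]
  have "((\<lambda>t. sqrt (speed_sq (v t) (\<theta> t))) has_real_derivative inverse w / 2 * (2 * w * angvel_rate (v t) (\<theta> t) w)) (at t within I)"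
    by (simp add: w_def)
  moreover have "inverse w / 2 * (2 * w * z) = z" for z using w0 by simp
  ultimately show ?thesis by (simp only: w_def[symmetric])
qed

text \<open>
  While the expression under the root is positive, the planar solution lifts to a trajectory in \<open>\<Delta>\<close>. At
  its first zero this trajectory would violate \<open>angvel_stays_positive\<close>; so there is
  no such time, and the lift is defined for all \<open>t \<ge> 0\<close>.
\<close>

lemma forward_solution_exists:
  assumes mem: "p \<in> \<Delta>" and reg: "p \<in> region" and pos: "0 < snd (snd p)"
  shows "\<exists>x. solution_in X \<Delta> {0..} x \<and> x 0 = p"
proof -
  obtain v0 \<theta>0 w0 where p: "p = (v0, \<theta>0, w0)" by (cases p)
  obtain C where C: "\<And>q. norm (planar_field q) \<le> C" using planar_field_bounded by blast
  obtain z where z0: "z 0 = (v0, \<theta>0)"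
    and z: "\<And>t. 0 \<le> t \<Longrightarrow> (z has_vector_derivative planar_field (z t)) (at t within {0..})"
    using peano_existence[OF planar_field_continuous C, of "(v0, \<theta>0)"] by blast
  define v \<theta> where "v t = fst (z t)" and "\<theta> t = snd (z t)" for t
  define e where "e t = speed_sq (v t) (clamp_angle (\<theta> t))" for t
  define y where "y t = (v t, clamp_angle (\<theta> t), sqrt (max 0 (e t)))" for t
  have zv: "planar_field (z t) = (min 0 (vel_rate (v t) (clamp_angle (\<theta> t))), sqrt (max 0 (e t)))" for t
    unfolding planar_field_def e_def v_def \<theta>_def by (simp add: case_prod_beta)
  have dv: "(v has_real_derivative min 0 (vel_rate (v t) (clamp_angle (\<theta> t)))) (at t within {0..})"
    and d\<theta>: "(\<theta> has_real_derivative sqrt (max 0 (e t))) (at t within {0..})" if "0 \<le> t" for t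
    using bounded_linear.has_vector_derivative[OF bounded_linear_fst z[OF that]]
      bounded_linear.has_vector_derivative[OF bounded_linear_snd z[OF that]]
    by (simp_all add: has_real_derivative_iff_has_vector_derivative v_def[abs_def] \<theta>_def[abs_def] zv[unfolded v_def \<theta>_def])
  have cv: "continuous_on {0..} v" and c\<theta>: "continuous_on {0..} \<theta>"
    using dv d\<theta> by (auto intro!: DERIV_continuous_on)
  have ccl: "continuous_on {0..} (\<lambda>t. clamp_angle (\<theta> t))" by (rule continuous_clamp[OF c\<theta>])
  have ce: "continuous_on {0..} e" unfolding e_def by (rule continuous_speed_sq_clamp[OF cv c\<theta>])
  have cy: "continuous_on {0..} y"
    unfolding y_def by (intro continuous_intros cv ccl ce)
  have th0: "- (pi / 2) < \<theta>0" "\<theta>0 < pi / 2"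
    using reg cos_theta_w unfolding p region_def by auto
  have e0: "e 0 = w0\<^sup>2" and clamp0: "clamp_angle (\<theta> 0) = \<theta>0"
  proof -
    show c: "clamp_angle (\<theta> 0) = \<theta>0" using th0 by (simp add: clamp_angle_def \<theta>_def z0)
    show "e 0 = w0\<^sup>2" using mem unfolding e_def c speed_sq_def p Delta_iff by (simp add: v_def z0)
  qed
  have y0: "y 0 = p" using pos e0 clamp0 by (simp add: y_def p v_def z0)
  have yD: "y t \<in> \<Delta>" if "0 \<le> e t" for t
    using that unfolding y_def Delta_iff by (intro conjI clamp_bounds) (simp add: e_def speed_sq_def)
  have th_mono: "\<theta>0 \<le> \<theta> t" if "0 \<le> t" for t
  proof -
    have "\<theta> 0 \<le> \<theta> t"
    proof (rule DERIV_nonneg_imp_increasing_open[OF that])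
      show "continuous_on {0..t} \<theta>" using c\<theta> by (auto intro: continuous_on_subset)
      fix r assume "0 < r" "r < t"
      then show "\<exists>y. (\<theta> has_real_derivative y) (at r) \<and> 0 \<le> y"
        using d\<theta>[of r] at_within_interior[of r "{0..}"] by (intro exI[of _ "sqrt (max 0 (e r))"]) auto
    qed
    then show ?thesis by (simp add: \<theta>_def z0)
  qed
  have unclamped: "clamp_angle (\<theta> t) = \<theta> t" if "0 \<le> t" "0 < e t" for t
  proof -
    have "\<theta> t < pi / 2"
    proof (rule ccontr)
      assume "\<not> \<theta> t < pi / 2"
      then have "clamp_angle (\<theta> t) = pi / 2" by (simp add: clamp_angle_def)
      then have "e t = 0" unfolding e_def speed_sq_def by (simp only: cos_pi_half) simp
      then show False using that by simp
    qed
    then show ?thesis using th_mono[OF that(1)] th0 by (simp add: clamp_angle_def)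
  qed
  have ydiff: "(y has_vector_derivative X (y t)) (at t within J)"
    if J: "J \<subseteq> {0..}" "\<And>r. r \<in> J \<Longrightarrow> 0 < e r" and t: "t \<in> J" for J t
  proof -
    have id: "clamp_angle (\<theta> r) = \<theta> r" "e r = speed_sq (v r) (\<theta> r)" "0 < speed_sq (v r) (\<theta> r)"
      "y r = (v r, \<theta> r, sqrt (speed_sq (v r) (\<theta> r)))" if "r \<in> J" for r
    proof -
      have pos: "0 < e r" by (rule J(2)[OF that])
      show c: "clamp_angle (\<theta> r) = \<theta> r" using unclamped[OF _ pos] J(1) that by auto
      then show eq: "e r = speed_sq (v r) (\<theta> r)" by (simp add: e_def)
      show "0 < speed_sq (v r) (\<theta> r)" using pos eq by simp
      show "y r = (v r, \<theta> r, sqrt (speed_sq (v r) (\<theta> r)))"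
        using pos unfolding y_def c eq by (simp add: max_def)
    qed
    have t0: "0 \<le> t" using J t by auto
    have c: "0 \<le> cos (\<theta> t)" using cos_clamp_nonneg[of "\<theta> t"] id(1)[OF t] by simp
    have "vel_rate (v t) (\<theta> t) \<le> 0"
      using vel_rate_nonpos yD[of t] J(2)[OF t] id(4)[OF t] by (metis less_imp_le)
    then have v': "(v has_real_derivative vel_rate (v t) (\<theta> t)) (at t within J)"
      using DERIV_subset[OF dv[OF t0] J(1)] id(1)[OF t] by (simp add: min_def split: if_splits)
    have \<theta>': "(\<theta> has_real_derivative sqrt (speed_sq (v t) (\<theta> t))) (at t within J)"
      using DERIV_subset[OF d\<theta>[OF t0] J(1)] id(2,3)[OF t] by (simp add: max_def)
    note w' = speed_derivative[OF v' \<theta>' c id(3)[OF t]]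
    have "((\<lambda>r. (v r, \<theta> r, sqrt (speed_sq (v r) (\<theta> r)))) has_vector_derivative X (y t)) (at t within J)"
      unfolding id(4)[OF t] X_eq
      by (intro has_vector_derivative_Pair v'[unfolded has_real_derivative_iff_has_vector_derivative]
          \<theta>'[unfolded has_real_derivative_iff_has_vector_derivative]
          w'[unfolded has_real_derivative_iff_has_vector_derivative])
    then show ?thesis by (rule has_vector_derivative_transform[OF t id(4), rotated])
  qed
  have epos: "0 < e t" if t: "0 \<le> t" for t
  proof (rule ccontr)
    assume "\<not> 0 < e t"
    have "continuous_on {0..t} e" using ce by (auto intro: continuous_on_subset)
    moreover have "0 < e 0" using pos e0 by (simp add: p)
    ultimately obtain T where T: "0 < T" "e T = 0" and before: "\<And>r. 0 \<le> r \<Longrightarrow> r < T \<Longrightarrow> 0 < e r"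
      using first_zero[of 0 t e] t \<open>\<not> 0 < e t\<close> by (auto simp: not_less)
    have "trajectory 0 T y"
      unfolding trajectory_def
    proof (intro conjI ballI)
      show "continuous_on {0..T} y" using cy by (auto intro: continuous_on_subset)
      show "y r \<in> \<Delta>" if "r \<in> {0..T}" for r
        using yD[of r] before[of r] T that by (cases "r = T") auto
      fix r assume r: "r \<in> {0<..<T}"
      have "(y has_vector_derivative X (y r)) (at r within {0<..<T})"
      proof (rule ydiff[OF _ _ r])
        show "{0<..<T} \<subseteq> {0..}" by auto
        show "0 < e s" if "s \<in> {0<..<T}" for s using before[of s] that by simp
      qed
      then show "(y has_vector_derivative X (y r)) (at r)" 
        unfolding at_within_open[OF r open_greaterThanLessThan] .
    qed
    from angvel_stays_positive[OF this, of T] have "0 < angvel y T"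
      using T y0 reg pos by simp
    then show False using T(2) by (simp add: y_def)
  qed
  have "solution_in X \<Delta> {0..} y"
    unfolding solution_in_def
  proof (intro ballI conjI)
    fix t :: real assume t: "t \<in> {0..}"
    then show "y t \<in> \<Delta>" using epos by (intro yD less_imp_le) simp
    show "(y has_vector_derivative X (y t)) (at t within {0..})"
      using t epos by (intro ydiff) simp_all
  qed
  with y0 show ?thesis by blast
qed

section \<open>The angle condition\<close>

text \<open>
  Both \<open>S\<close> and \<open>\<theta>\<^sub>w\<close> are nonnegative and \<open>\<theta>\<^sub>w < \<pi>/2\<close>. So \<open>S < \<theta>\<^sub>w\<close> would give
  \<open>cos\<^sup>2 S > cos\<^sup>2 \<theta>\<^sub>w\<close>, whereas \<open>\<theta>\<^sub>w \<le> S\<close> is the claim after multiplication by \<open>k\<close>.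
\<close>

lemma angle_criterion:
  assumes "0 \<le> S" and S2: "S\<^sup>2 = 4 * (Wf tw / Wf 0)" and cos: "(cos S)\<^sup>2 \<le> (cos tw)\<^sup>2"
  shows "k * tw \<le> Vm"
proof -
  have W0: "0 < Wf 0" by (rule W_pos) simp
  have "tw \<le> S"
  proof (rule ccontr)
    assume "\<not> tw \<le> S"
    then have "cos tw < cos S" using cos_theta_w \<open>0 \<le> S\<close> by (intro cos_monotone_0_pi) auto
    then have "(cos tw)\<^sup>2 < (cos S)\<^sup>2" using cos_tw_pos by (intro power_strict_mono) auto
    with cos show False by linarith
  qed
  then have "k * tw \<le> k * S" using W0 by (intro mult_left_mono) auto
  also have "k * S \<le> Vm"
  proof (rule real_le_rsqrt)
    have "k\<^sup>2 = Wf 0 / 2" using W0 by simp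
    then show "(k * S)\<^sup>2 \<le> 2 * Wf tw" unfolding power_mult_distrib S2 using W0 by simp
  qed
  finally show ?thesis .
qed

lemma lam_ratio: "lam / (\<mu> - 1) = (16 * B1 / B) powr (2/5) / (\<mu> - 1) powr (3/5)"
proof -
  have "lam = (\<mu> - 1) powr (2/5) * (16 * B1 / B) powr (2/5)"
    unfolding lam_def by (rule powr_mult)
  moreover have "\<mu> - 1 = (\<mu> - 1) powr (2/5) * (\<mu> - 1) powr (3/5)"
    using mu_gt_1 by (simp flip: powr_add)
  moreover have "0 < (\<mu> - 1) powr (2/5)" using mu_gt_1 by simp
  ultimately show ?thesis by (metis less_numeral_extra(3) mult_divide_mult_cancel_left)
qed

lemma cos_tw_sq: "(cos tw)\<^sup>2 = 1 / ((1 - 1 / \<mu>) * (1 + lam / (\<mu> - 1)))"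
proof -
  have "(1 - 1 / \<mu>) * (1 + lam / (\<mu> - 1)) = ((\<mu> - 1) + lam) / \<mu>"
    using mu_gt_1 by (simp add: field_simps)
  then show ?thesis using cos_theta_w(1) by simp
qed

lemma W_ratio:
  "((4 / (1 + 16 * B1 / B)) powr (1/2) * (1 - 1 / \<mu>) powr (3/4) * (1 + lam / (\<mu> - 1)) powr (5/4))\<^sup>2
    = 4 * (Wf tw / Wf 0)"
proof -
  define a b g where "a = 1 - 1 / \<mu>" and "b = 1 + lam / (\<mu> - 1)" and "g = 1 + 16 * B1 / B"
  have pos: "0 < a" "0 < b" "0 < g"
    using mu_gt_1 lam_gt_1 B_pos B1_pos by (auto simp: a_def b_def g_def intro!: add_pos_pos)
  have sq: "(x powr r)\<^sup>2 = x powr (2 * r)" for x r :: real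
    by (simp add: power2_eq_square flip: powr_add)
  have "cos tw ^ 3 = ((cos tw)\<^sup>2) powr (3/2)"
    using cos_tw_pos by (simp add: powr_powr flip: powr_numeral)
  also have "\<dots> = inverse ((a * b) powr (3/2))"
    using pos unfolding cos_tw_sq a_def[symmetric] b_def[symmetric] by (simp only: powr_divide powr_one_eq_one inverse_eq_divide)
  finally have "Wf tw = \<kappa> * B * b * (a * b) powr (3/2)" 
    unfolding W_tw b_def by (simp only: divide_inverse inverse_inverse_eq)
  moreover have "b * (a * b) powr (3/2) = a powr (3/2) * b powr (5/2)"
    using pos powr_add[of b 1 "3/2"] by (simp add: powr_mult)
  ultimately have "Wf tw = \<kappa> * B * (a powr (3/2) * b powr (5/2))" by (simp only: mult.assoc)
  then have "Wf tw / Wf 0 = a powr (3/2) * b powr (5/2) / g"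
    using B_pos M_pos unfolding W_0 g_def by simp
  moreover have "((4 / g) powr (1/2) * a powr (3/4) * b powr (5/4))\<^sup>2 = 4 / g * (a powr (3/2) * b powr (5/2))"
    unfolding power_mult_distrib sq using pos by simp
  ultimately show ?thesis unfolding a_def b_def g_def by simp
qed

end

theorem corollary3:
  fixes M m A A1 B B1 \<mu> \<gamma> :: real
    and \<Delta> :: "(real \<times> real \<times> real) set"
    and X :: "real \<times> real \<times> real \<Rightarrow> real \<times> real \<times> real"
  assumes "M > 0" "m > 0" "A > 0" "A1 > 0" "B > 0" "B1 > 0"
    and "\<mu> = (2 * M + m) / m"
    and "\<gamma> = 16 * B1 / B"
    and "\<Delta> = triple_collision_manifold M \<mu> B B1"
    and "X = schwarzschild_field M \<mu> B B1"
    and "\<mu> > 1 + A / (4 * A1)"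
    and "\<mu> > 1 + B / (16 * B1)"
    and "(\<mu> - 1) powr (4/15) * (4 * A1 / A) powr (2/3) \<noteq> (16 * B1 / B) powr (2/5)"
    and "(cos ((4 / (1 + \<gamma>)) powr (1/2) * (1 - 1 / \<mu>) powr (3/4)
               * (1 + \<gamma> powr (2/5) / (\<mu> - 1) powr (3/5)) powr (5/4)))\<^sup>2
         \<le> 1 / ((1 - 1 / \<mu>) * (1 + \<gamma> powr (2/5) / (\<mu> - 1) powr (3/5)))"
  shows "\<forall>p \<in> unstable_branch X \<Delta> (E_minus M \<mu> B B1) {(v, \<theta>, w). w > 0}.
           (\<exists>x. solution_in X \<Delta> {0..} x \<and> x 0 = p) \<and>
           (\<forall>x. solution_in X \<Delta> {0..} x \<and> x 0 = p \<longrightarrow>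
                ((\<lambda>t. fst (snd (x t))) \<longlongrightarrow> pi / 2) at_top \<and>
                ((\<lambda>t. snd (snd (x t))) \<longlongrightarrow> 0) at_top)"
proof -
  interpret P: isosceles_potential M \<mu> B B1
    using assms(1,5,6,12) by unfold_locales
  let ?S = "(4 / (1 + \<gamma>)) powr (1/2) * (1 - 1 / \<mu>) powr (3/4)
               * (1 + \<gamma> powr (2/5) / (\<mu> - 1) powr (3/5)) powr (5/4)"
  have ratio: "\<gamma> powr (2/5) / (\<mu> - 1) powr (3/5) = P.lam / (\<mu> - 1)"
    unfolding assms(8) by (rule P.lam_ratio[symmetric])
  have gap: "P.k * P.tw \<le> P.Vm"
  proof (rule P.angle_criterion)
    show "0 \<le> ?S" by simp
    show "?S\<^sup>2 = 4 * (P.Wf P.tw / P.Wf 0)" unfolding ratio unfolding assms(8) by (rule P.W_ratio)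
    show "(cos ?S)\<^sup>2 \<le> (cos P.tw)\<^sup>2" using assms(14) unfolding P.cos_tw_sq ratio .
  qed
  show ?thesis
  proof
    fix p assume "p \<in> unstable_branch X \<Delta> (E_minus M \<mu> B B1) {(v, \<theta>, w). w > 0}"
    then have "p \<in> P.\<Delta>" and reg: "p \<in> P.region" and pos: "0 < snd (snd p)"
      using P.unstable_branch_in_region[OF gap] unfolding assms(9,10) by blast+
    then have "\<exists>x. solution_in X \<Delta> {0..} x \<and> x 0 = p"
      using P.forward_solution_exists unfolding assms(9,10) by blast
    moreover have "((\<lambda>t. fst (snd (x t))) \<longlongrightarrow> pi / 2) at_top \<and> ((\<lambda>t. snd (snd (x t))) \<longlongrightarrow> 0) at_top"
      if "solution_in X \<Delta> {0..} x" "x 0 = p" for x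
      using P.forward_limits[of x] that reg pos unfolding assms(9,10) by blast
    ultimately show "(\<exists>x. solution_in X \<Delta> {0..} x \<and> x 0 = p) \<and>
           (\<forall>x. solution_in X \<Delta> {0..} x \<and> x 0 = p \<longrightarrow>
                ((\<lambda>t. fst (snd (x t))) \<longlongrightarrow> pi / 2) at_top \<and>
                ((\<lambda>t. snd (snd (x t))) \<longlongrightarrow> 0) at_top)" by blast
  qed
qed

end
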